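(* There exist complex vectors $\mathbf{q}_1,\dots,\mathbf{q}_{n_{\mathrm{per}}-1}$ (resp. $\mathbf{v}_1,\dots,\mathbf{v}_{n_{\mathrm{per}}-1}$) that are right (resp. left) eigenvectors of $W^\top$ related to the eigenvalues of modulus equal to $1$ but different from $1$ (i.e. the complex $n_{\mathrm{per}}$-th roots of unity different from $1$), and complex vectors $\mathbf{r}_1,\dots,\mathbf{r}_{N-n_{\mathrm{per}}}$ (resp. $\mathbf{p}_1,\dots,\mathbf{p}_{N-n_{\mathrm{per}}}$) that are right (resp. left), possibly generalized, eigenvectors of $W^\top$ related to the eigenvalues with modulus strictly smaller than $1$, such that, for every $n\ge 0$, $$\mathbf{Z}_n^{(1)}=\mathbf{1}\mathbf{v}^\top\mathbf{Z}_n\in \mathrm{Span}\{\mathbf{1}\},\qquad \mathbf{Z}_n^{(2)}=\sum_{j=1}^{n_{\mathrm{per}}-1}\mathbf{q}_j\mathbf{v}_j^\top\mathbf{Z}_n\in \mathrm{Span}\{\mathbf{q}_1,\dots,\mathbf{q}_{n_{\mathrm{per}}-1}\},$$ $$\mathbf{Z}_n^{(3)}=\sum_{j=1}^{N-n_{\mathrm{per}}}\mathbf{r}_j\mathbf{p}_j^\top\mathbf{Z}_n\in \mathrm{Span}\{\mathbf{r}_1,\dots,\mathbf{r}_{N-n_{\mathrm{per}}}\}$$ (with the convention $\sum_{j=1}^{0}\dots=0$). As a consequence, the three components $\mathbf{Z}_n^{(i)}$, $i=1,2,3$, are linearly independent (they lie in linearly independent subspaces), and the complete almost sure asymptotic synchronization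 of the system holds if and only if both $\mathbf{Z}_n^{(2)}$ and $\mathbf{Z}_n^{(3)}$ converge almost surely to $\mathbf{0}$ as $n\to\infty$.
   Context: Let $N\ge 2$, $V=\{1,\dots,N\}$, and let $W=[w_{l_1,l_2}]_{l_1,l_2\in V}$ be an irreducible real matrix with non-negative entries such that $W^\top\mathbf{1}=\mathbf{1}$, where $\mathbf{1}$ is the all-ones vector ($\mathbf{0}$ is the zero vector). Let $(r_n)_{n\ge0}$ be a deterministic sequence with $0\le r_n<1$. Let $\mathbf{Z}_0=[Z_{0,1},\dots,Z_{0,N}]^\top$ be a random vector with values in $[0,1]^N$ and, for $n\ge 0$, let $\mathcal{F}_n=\sigma(Z_{0,l}:l\in V)\vee\sigma(X_{k,l}:1\le k\le n,\,l\in V)$. Given $\mathcal{F}_n$, the random variables $X_{n+1,l}$, $l\in V$, are $\{0,1\}$-valued and conditionally independent with $P(X_{n+1,l}=1\mid\mathcal{F}_n)=\sum_{l_1=1}^N w_{l_1,l}Z_{n,l_1}=[W^\top\mathbf{Z}_n]_l$, and $\mathbf{Z}_{n+1}=(1-r_n)\mathbf{Z}_n+r_n\mathbf{X}_{n+1}$, where $\mathbf{X}_{n}=[X_{n,1},\dots,X_{n,N}]^\top$, $\mathbf{Z}_{n}=[Z_{n,1},\dots,Z_{n,N}]^\top$. Let $n_{\mathrm{per}}\ge1$ be the period of the irreducible matrix $W^\top$ ($\gcd\{k\ge1:[(W^\top)^k]_{l,l}>0\}$, independent of $l$). The set $V$ is partitioned into $n_{\mathrm{per}}$ cyclic classes,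 numbered $0,\dots,n_{\mathrm{per}}-1$ (numbers modulo $n_{\mathrm{per}}$), such that $[W^\top]_{l_1,l_2}=0$ when $l_1$ is in class $h$ and $l_2$ is not in class $h+1$; they are the communicating classes of $(W^\top)^{n_{\mathrm{per}}}$. Write $l_1\sim_c l_2$ if $l_1,l_2$ are in the same cyclic class. Let $\mathbf{v}$ be the unique vector with strictly positive entries with $\mathbf{v}^\top W^\top=\mathbf{v}^\top$ and $\mathbf{v}^\top\mathbf{1}=1$. Decomposition $\mathbf{Z}_n=\mathbf{Z}_n^{(1)}+\mathbf{Z}_n^{(2)}+\mathbf{Z}_n^{(3)}$: set $\widetilde Z_n=\mathbf{v}^\top\mathbf{Z}_n$, $\mathbf{Z}_n^{(1)}=\widetilde Z_n\mathbf{1}$; set $Z_{n,l}^{(C)}=\sum_{l_1\sim_c l}\frac{v_{l_1}}{\sum_{l_2\sim_c l}v_{l_2}}Z_{n,l_1}$ for $l\in V$ and $\mathbf{Z}_n^{(2)}=\mathbf{Z}_n^{(C)}-\widetilde Z_n\mathbf{1}$; finally $\mathbf{Z}_n^{(3)}=\mathbf{Z}_n-\mathbf{Z}_n^{(1)}-\mathbf{Z}_n^{(2)}$. Complete almost sure asymptotic synchronization means: $Z_{n,l_2}-Z_{n,l_1}\to0$ almost surely for each pair $(l_1,l_2)\in V\times V$. A left eigenvector $\mathbf{x}$ of $W^\top$ for $\lambda$ satisfies $\mathbf{x}^\top W^\top=\lambda\mathbf{x}^\top$ (no conjugation). Spans are over $\mathbb{C}$. *)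

theory Defs
  imports "HOL-Probability.Probability"
begin

section \<open>Matrices\<close>

text \<open>The power of the library on \<open>real ^ 'n ^ 'n\<close> is entrywise, hence a separate matrix power.\<close>

primrec matpow :: "'a::semiring_1 ^ 'n ^ 'n \<Rightarrow> nat \<Rightarrow> 'a ^ 'n ^ 'n" where
  "matpow A 0 = mat 1"
| "matpow A (Suc k) = A ** matpow A k"

definition nonneg_matrix :: "real ^ 'n ^ 'm \<Rightarrow> bool" where
  "nonneg_matrix A \<longleftrightarrow> (\<forall>i j. 0 \<le> A $ i $ j)"

text \<open>Meaningful for nonnegative matrices only, where positive entries of powers witness paths.\<close>

definition irreducible_matrix :: "real ^ 'n ^ 'n \<Rightarrow> bool" where
  "irreducible_matrix A \<longleftrightarrow> (\<forall>i j. \<exists>k\<ge>1. matpow A k $ i $ j > 0)"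

definition period_at :: "real ^ 'n ^ 'n \<Rightarrow> 'n \<Rightarrow> nat" where
  "period_at A l = Gcd {k. 1 \<le> k \<and> matpow A k $ l $ l > 0}"

text \<open>Well defined for irreducible nonnegative \<open>A\<close>, where \<open>period_at A l\<close> does not depend on
  \<open>l\<close>.\<close>

definition period :: "real ^ 'n ^ 'n \<Rightarrow> nat" where
  "period A = (THE d. \<forall>l. period_at A l = d)"

definition communicates :: "real ^ 'n ^ 'n \<Rightarrow> 'n \<Rightarrow> 'n \<Rightarrow> bool" where
  "communicates A i j \<longleftrightarrow> (\<exists>k. matpow A k $ i $ j > 0) \<and> (\<exists>k. matpow A k $ j $ i > 0)"

text \<open>The cyclic classes of \<open>A\<close> are the communicating classes of \<open>A\<close> raised to its period.\<close>

definition same_cyclic_class :: "real ^ 'n ^ 'n \<Rightarrow> 'n \<Rightarrow> 'n \<Rightarrow> bool" where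
  "same_cyclic_class A i j \<longleftrightarrow> communicates (matpow A (period A)) i j"


section \<open>Complex vectors and eigenvectors\<close>

definition cvec :: "real ^ 'n \<Rightarrow> complex ^ 'n" where
  "cvec x = (\<chi> i. complex_of_real (x $ i))"

definition cmat :: "real ^ 'n ^ 'm \<Rightarrow> complex ^ 'n ^ 'm" where
  "cmat A = (\<chi> i j. complex_of_real (A $ i $ j))"

text \<open>The product \<open>x\<^sup>T y\<close>, without conjugation (\<open>\<bullet>\<close> on complex vectors is the real inner product).\<close>

definition tdot :: "complex ^ 'n \<Rightarrow> complex ^ 'n \<Rightarrow> complex" where
  "tdot x y = (\<Sum>i\<in>UNIV. x $ i * y $ i)"

definition right_eigenvector :: "complex ^ 'n ^ 'n \<Rightarrow> complex \<Rightarrow> complex ^ 'n \<Rightarrow> bool" where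
  "right_eigenvector A \<mu> x \<longleftrightarrow> x \<noteq> 0 \<and> A *v x = \<mu> *s x"

definition left_eigenvector :: "complex ^ 'n ^ 'n \<Rightarrow> complex \<Rightarrow> complex ^ 'n \<Rightarrow> bool" where
  "left_eigenvector A \<mu> x \<longleftrightarrow> x \<noteq> 0 \<and> x v* A = \<mu> *s x"

definition eigenvalues :: "complex ^ 'n ^ 'n \<Rightarrow> complex set" where
  "eigenvalues A = {\<mu>. \<exists>x. right_eigenvector A \<mu> x}"

definition gen_right_eigenvector :: "complex ^ 'n ^ 'n \<Rightarrow> complex \<Rightarrow> complex ^ 'n \<Rightarrow> bool" where
  "gen_right_eigenvector A \<mu> x \<longleftrightarrow> x \<noteq> 0 \<and> (\<exists>k. matpow (A - mat \<mu>) k *v x = 0)"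

definition gen_left_eigenvector :: "complex ^ 'n ^ 'n \<Rightarrow> complex \<Rightarrow> complex ^ 'n \<Rightarrow> bool" where
  "gen_left_eigenvector A \<mu> x \<longleftrightarrow> x \<noteq> 0 \<and> (\<exists>k. x v* matpow (A - mat \<mu>) k = 0)"

definition independent_subspaces3 ::
    "(complex ^ 'n) set \<Rightarrow> (complex ^ 'n) set \<Rightarrow> (complex ^ 'n) set \<Rightarrow> bool" where
  "independent_subspaces3 S T U \<longleftrightarrow>
     (\<forall>x\<in>S. \<forall>y\<in>T. \<forall>z\<in>U. x + y + z = 0 \<longrightarrow> x = 0 \<and> y = 0 \<and> z = 0)"


section \<open>Conditional probability\<close>

definition cond_probability :: "'w measure \<Rightarrow> 'w measure \<Rightarrow> 'w set \<Rightarrow> 'w \<Rightarrow> real" where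
  "cond_probability M F A = real_cond_exp M F (indicator A)"

definition cond_indep_vars ::
    "'w measure \<Rightarrow> 'w measure \<Rightarrow> ('i \<Rightarrow> 'b measure) \<Rightarrow> ('i \<Rightarrow> 'w \<Rightarrow> 'b) \<Rightarrow> 'i set \<Rightarrow> bool" where
  "cond_indep_vars M F M' Y I \<longleftrightarrow>
     (\<forall>i\<in>I. Y i \<in> measurable M (M' i)) \<and>
     (\<forall>J\<subseteq>I. finite J \<longrightarrow> J \<noteq> {} \<longrightarrow> (\<forall>A. (\<forall>i\<in>J. A i \<in> sets (M' i)) \<longrightarrow>
        (AE \<omega> in M. cond_probability M F {\<omega>' \<in> space M. \<forall>i\<in>J. Y i \<omega>' \<in> A i} \<omega> =
                    (\<Prod>i\<in>J. cond_probability M F {\<omega>' \<in> space M. Y i \<omega>' \<in> A i} \<omega>))))"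


section \<open>The interacting system\<close>

text \<open>The \<open>\<sigma>\<close>-algebra generated by the components of \<open>Z 0\<close> and of \<open>X k\<close> for \<open>1 \<le> k \<le> n\<close>; the value
  \<open>X 0\<close> is never used.\<close>

definition history ::
    "'w measure \<Rightarrow> (nat \<Rightarrow> 'w \<Rightarrow> real ^ 'n) \<Rightarrow> (nat \<Rightarrow> 'w \<Rightarrow> real ^ 'n) \<Rightarrow> nat \<Rightarrow> 'w measure" where
  "history M Z X n = sigma (space M)
     ({(\<lambda>\<omega>. Z 0 \<omega> $ l) -` B \<inter> space M | l B. B \<in> sets borel} \<union>
      {(\<lambda>\<omega>. X k \<omega> $ l) -` B \<inter> space M | k l B. 1 \<le> k \<and> k \<le> n \<and> B \<in> sets borel})"

definition comp1 :: "real ^ 'n \<Rightarrow> real ^ 'n \<Rightarrow> real ^ 'n" where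
  "comp1 v z = (v \<bullet> z) *s 1"

definition class_mean :: "real ^ 'n ^ 'n \<Rightarrow> real ^ 'n \<Rightarrow> real ^ 'n \<Rightarrow> real ^ 'n" where
  "class_mean A v z = (\<chi> l. \<Sum>l1 | same_cyclic_class A l1 l.
     v $ l1 / (\<Sum>l2 | same_cyclic_class A l2 l. v $ l2) * z $ l1)"

definition comp2 :: "real ^ 'n ^ 'n \<Rightarrow> real ^ 'n \<Rightarrow> real ^ 'n \<Rightarrow> real ^ 'n" where
  "comp2 A v z = class_mean A v z - (v \<bullet> z) *s 1"

definition comp3 :: "real ^ 'n ^ 'n \<Rightarrow> real ^ 'n \<Rightarrow> real ^ 'n \<Rightarrow> real ^ 'n" where
  "comp3 A v z = z - comp1 v z - comp2 A v z"

definition complete_as_synchronization :: "'w measure \<Rightarrow> (nat \<Rightarrow> 'w \<Rightarrow> real ^ 'n) \<Rightarrow> bool" where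
  "complete_as_synchronization M Z \<longleftrightarrow>
     (\<forall>l1 l2. AE \<omega> in M. (\<lambda>n. Z n \<omega> $ l2 - Z n \<omega> $ l1) \<longlonglongrightarrow> 0)"

end

theory Submission
  imports Defs "HOL-Number_Theory.Cong" "Jordan_Normal_Form.Jordan_Normal_Form_Existence"
begin

text \<open>
  A walk of positive weight from a base vertex to \<open>l\<close> has a length that is determined modulo the
  period \<open>d\<close>; this residue is the number of the cyclic class of \<open>l\<close>. For every \<open>d\<close>-th root of unity
  \<open>\<mu>\<close> the vector with entries \<open>\<mu> ^ cls l\<close> is a right eigenvector, and \<open>v $ l / \<mu> ^ cls l\<close> is the
  dual left eigenvector. The maximum modulus argument shows that there is no other unimodular
  eigenvector up to scaling, and orthogonality of characters identifies the sum of the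
  corresponding rank one projections with the class mean. Over a Jordan basis with its dual basis,
  the complementary projection kills exactly the basis vectors whose eigenvalue is a root of unity
  and fixes the others, so it is the sum of the rank one projections of the contracting basis
  vectors; their number \<open>N - d\<close> is read off the trace.
\<close>

section \<open>Jordan bases\<close>

text \<open>From here on, vector and matrix names and symbols are those of \<open>HOL-Analysis\<close>.\<close>

hide_const (open) Matrix.mat Matrix.row Matrix.vec Matrix.col
hide_type (open) Matrix.vec
hide_fact (open) Matrix.mat_def Matrix.row_def Matrix.col_def Matrix.vec_def Matrix.vec_eq_iff
no_notation vec_index (infixl "$" 100)
no_notation scalar_prod (infix "\<bullet>" 70)

text \<open>Only two features of the Jordan form are kept: it is upper triangular, and an
  off-diagonal entry can join only positions with equal diagonal entries. This is all that the
  nilpotency argument for generalized eigenvectors needs, so the exact block sizes can be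
  forgotten.\<close>

lemma jordan_matrix_entry:
  assumes "i < sum_list (map fst n_as)" "j < sum_list (map fst n_as)"
    and "jordan_matrix n_as $$ (i, j) \<noteq> (0 :: 'a :: {zero, one})"
  shows "i = j \<or> (i < j \<and> jordan_matrix n_as $$ (i, i) = jordan_matrix n_as $$ (j, j))"
  using assms
proof (induction n_as arbitrary: i j)
  case Nil
  then show ?case by simp
next
  case (Cons x n_as)
  obtain n a where x: "x = (n, a)" by force
  define K where "K = jordan_matrix n_as"
  define m where "m = sum_list (map fst n_as)"
  have K: "dim_row K = m" "dim_col K = m"
    by (simp_all add: K_def m_def)
  \<comment> \<open>Splitting off the first block makes the matrix block diagonal; the remaining
    blocks sit at an offset of \<open>n\<close>, which is the shift seen by the induction
    hypothesis.\<close>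
  have entry: "jordan_matrix (x # n_as) $$ (k, l) =
      (if k < n then if l < n then jordan_block n a $$ (k, l) else 0
       else if l < n then 0 else K $$ (k - n, l - n))" if "k < n + m" "l < n + m" for k l
    using that unfolding x jordan_matrix_Cons
    by (subst index_mat_four_block) (auto simp: K simp flip: K_def m_def)
  have ij: "i < n + m" "j < n + m"
    using Cons.prems(1,2) by (simp_all add: x m_def)
  have nonzero: "jordan_matrix (x # n_as) $$ (i, j) \<noteq> 0" by (rule Cons.prems(3))
  consider "i < n" "j < n" | "n \<le> i" "n \<le> j" "K $$ (i - n, j - n) \<noteq> 0"
    using nonzero entry[OF ij] by (auto split: if_splits)
  then show ?case
  proof cases
    case 1
    then show ?thesis using nonzero entry ij by (auto split: if_splits)
  next
    case 2
    then have "i - n = j - n \<or> i - n < j - n \<and> K $$ (i - n, i - n) = K $$ (j - n, j - n)"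
      using ij Cons.IH[of "i - n" "j - n"] by (simp add: K_def m_def)
    then show ?thesis using 2 entry ij by auto
  qed
qed

lemma bij_index: "\<exists>f :: 'n::finite \<Rightarrow> nat. bij_betw f UNIV {..<CARD('n)}"
  using ex_bij_betw_finite_nat[of "UNIV :: 'n set"] by (auto simp: atLeast0LessThan)

text \<open>The Jordan form is available for matrices indexed by initial segments of the naturals. A
  numbering \<open>f\<close> of the index type transports it, and the order of the positions
  survives as the order of the values of \<open>f\<close>.\<close>

lemma jordan_form_vec:
  fixes A :: "complex ^ 'n ^ 'n"
  obtains P Q J :: "complex ^ 'n ^ 'n" and f :: "'n \<Rightarrow> nat"
  where "P ** Q = mat 1" "Q ** P = mat 1" "A ** P = P ** J" "Q ** A = J ** Q"
    "\<And>i j. J $ i $ j \<noteq> 0 \<Longrightarrow> i = j \<or> (f i < f j \<and> J $ i $ i = J $ j $ j)"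
proof -
  let ?n = "CARD('n)"
  obtain f :: "'n \<Rightarrow> nat" where f: "bij_betw f UNIV {..<?n}"
    using bij_index by blast
  have f_lt: "f i < ?n" for i using f by (auto simp: bij_betw_def)
  have f_inj: "f i = f j \<longleftrightarrow> i = j" for i j using f by (auto simp: bij_betw_def inj_def)
  define g where "g = inv_into UNIV f"
  have gf: "g (f i) = i" for i unfolding g_def using f by (simp add: bij_betw_def)
  \<comment> \<open>\<open>T\<close> reads a matrix through the numbering. It preserves products and
    the identity, so the similarity of \<open>A'\<close> to its Jordan matrix turns into identities
    for \<open>A\<close>.\<close>
  define T :: "complex Matrix.mat \<Rightarrow> complex ^ 'n ^ 'n" where "T B = (\<chi> i j. B $$ (f i, f j))" for B
  define A' where "A' = Matrix.mat ?n ?n (\<lambda>(i, j). A $ g i $ g j)"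
  have A': "A' \<in> carrier_mat ?n ?n" and TA: "T A' = A"
    by (auto simp: A'_def T_def vec_eq_iff f_lt gf)
  have T_mult: "T (B * C) = T B ** T C"
    if "B \<in> carrier_mat ?n ?n" "C \<in> carrier_mat ?n ?n" for B C
    using that f_lt
    by (auto simp: T_def vec_eq_iff matrix_matrix_mult_def scalar_prod_def atLeast0LessThan
        simp flip: sum.reindex_bij_betw[OF f])
  have T_one: "T (1\<^sub>m ?n) = mat 1"
    by (auto simp: T_def vec_eq_iff mat_def f_lt f_inj)
  obtain n_as where "jordan_nf A' n_as"
    using char_poly_factorized[OF A'] jordan_nf_exists[OF A'] by blast
  then obtain P Q where "similar_mat_wit A' (jordan_matrix n_as) P Q"
    by (auto simp: jordan_nf_def similar_mat_def)
  note w = similar_mat_witD2[OF A' this]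
  let ?J = "jordan_matrix n_as"
  have size: "sum_list (map fst n_as) = ?n" using w(5) by (metis carrier_matD(1) jordan_matrix_dim(1))
  have PJ: "P * ?J \<in> carrier_mat ?n ?n" and JQ: "?J * Q \<in> carrier_mat ?n ?n"
    using w(5-7) by (metis mult_carrier_mat)+
  have AP: "A' * P = P * ?J"
  proof -
    have "A' * P = P * ?J * (Q * P)"
      unfolding w(3) by (rule assoc_mult_mat[OF PJ w(7,6)])
    also have "\<dots> = P * ?J" unfolding w(2) by (rule right_mult_one_mat[OF PJ])
    finally show ?thesis .
  qed
  have QA: "Q * A' = ?J * Q"
  proof -
    have "Q * A' = Q * (P * (?J * Q))"
      unfolding w(3) assoc_mult_mat[OF w(6,5,7)] ..
    also have "\<dots> = Q * P * (?J * Q)" by (rule assoc_mult_mat[OF w(7,6) JQ, symmetric])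
    also have "\<dots> = ?J * Q" unfolding w(2) by (rule left_mult_one_mat[OF JQ])
    finally show ?thesis .
  qed
  show thesis
  proof (rule that[of "T P" "T Q" "T ?J" f])
    show "T P ** T Q = mat 1" "T Q ** T P = mat 1"
      using w(1,2,6,7) by (simp_all flip: T_mult T_one)
    show "A ** T P = T P ** T ?J" "T Q ** A = T ?J ** T Q"
      using w(5-7) A' AP QA by (simp_all flip: T_mult TA)
    show "i = j \<or> (f i < f j \<and> T ?J $ i $ i = T ?J $ j $ j)" if "T ?J $ i $ j \<noteq> 0" for i j
      using that jordan_matrix_entry[of "f i" n_as "f j"] f_lt[of i] f_lt[of j] size
      by (auto simp: T_def f_inj)
  qed
qed

section \<open>Matrix powers and cyclic classes\<close>

lemma matpow_add: "matpow A (a + b) = matpow A a ** matpow A b"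
  by (induction a) (simp_all add: matrix_mul_assoc)

lemma matpow_mult: "matpow A (a * b) = matpow (matpow A a) b"
  by (induction b) (simp_all add: matpow_add)

lemma matpow_Suc_right: "matpow A (Suc k) = matpow A k ** A"
  using matpow_add[of A k 1] by simp

lemma matpow_transpose:
  fixes A :: "'a::comm_semiring_1 ^ 'n ^ 'n"
  shows "matpow (transpose A) k = transpose (matpow A k)"
proof (induction k)
  case (Suc k)
  have "matpow (transpose A) (Suc k) = transpose (matpow A k ** A)"
    using Suc by (simp add: matrix_transpose_mul)
  then show ?case by (simp only: matpow_Suc_right)
qed simp

lemma nonneg_matpow:
  assumes "nonneg_matrix A"
  shows "0 \<le> matpow A k $ i $ j"
  using assms
  by (induction k arbitrary: i j)
     (auto simp: nonneg_matrix_def mat_def matrix_matrix_mult_def intro!: sum_nonneg)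

lemma matpow_pos_add:
  assumes "nonneg_matrix A" "matpow A a $ i $ j > 0" "matpow A b $ j $ l > 0"
  shows "matpow A (a + b) $ i $ l > 0"
proof -
  have "0 < matpow A a $ i $ j * matpow A b $ j $ l"
    using assms by simp
  also have "\<dots> \<le> (\<Sum>k\<in>UNIV. matpow A a $ i $ k * matpow A b $ k $ l)"
    by (rule member_le_sum) (auto simp: nonneg_matpow assms(1))
  finally show ?thesis by (simp add: matpow_add matrix_matrix_mult_def)
qed

lemma matpow_Suc_posE:
  assumes "nonneg_matrix A" "matpow A (Suc k) $ i $ l > 0"
  obtains j where "A $ i $ j > 0" "matpow A k $ j $ l > 0"
proof -
  have "(\<Sum>j\<in>UNIV. A $ i $ j * matpow A k $ j $ l) > 0"
    using assms(2) by (simp add: matrix_matrix_mult_def)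
  then obtain j where "A $ i $ j * matpow A k $ j $ l > 0"
    by (meson not_le sum_nonpos)
  moreover have "A $ i $ j \<ge> 0" using assms(1) by (simp add: nonneg_matrix_def)
  moreover have "matpow A k $ j $ l \<ge> 0" using assms(1) by (rule nonneg_matpow)
  ultimately show thesis using that by (auto simp: zero_less_mult_iff)
qed

lemma irreducible_transpose:
  "irreducible_matrix A \<Longrightarrow> irreducible_matrix (transpose A)"
  unfolding irreducible_matrix_def matpow_transpose by (simp add: transpose_def)

lemma power_cong_root_of_unity:
  fixes x :: "'a::monoid_mult"
  assumes "x ^ d = 1" "[a = b] (mod d)"
  shows "x ^ a = x ^ b"
proof -
  have "x ^ k = x ^ (k mod d)" for k
  proof -
    have "x ^ k = x ^ (d * (k div d) + k mod d)" by simp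
    also have "\<dots> = x ^ (k mod d)"
      by (simp only: power_add power_mult assms(1) power_one mult_1_left)
    finally show ?thesis .
  qed
  then show ?thesis using assms(2) by (metis cong_def)
qed

text \<open>Here \<open>A\<close> stands for the transpose of \<open>W\<close>, so that
  \<open>A\<close> has row sums 1 and \<open>v\<close> is its stationary distribution. Spectral
  facts are proved for this \<open>A\<close> alone.\<close>

locale irreducible_stochastic =
  fixes A :: "real ^ 'n ^ 'n" and v :: "real ^ 'n"
  assumes nonneg: "nonneg_matrix A" and irred: "irreducible_matrix A"
    and stochastic: "A *v 1 = 1"
    and v_pos: "\<And>l. v $ l > 0" and v_left: "v v* A = v" and v_sum: "v \<bullet> 1 = 1"
begin

lemma row_sum: "(\<Sum>j\<in>UNIV. A $ i $ j) = 1"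
  using arg_cong[OF stochastic, of "\<lambda>x. x $ i"] by (simp add: matrix_vector_mult_def)

lemma sum_v: "(\<Sum>i\<in>UNIV. v $ i) = 1"
  using v_sum by (simp add: inner_vec_def)

lemma left_sum: "(\<Sum>i\<in>UNIV. v $ i * A $ i $ j) = v $ j"
  using arg_cong[OF v_left, of "\<lambda>x. x $ j"] by (simp add: vector_matrix_mult_def mult.commute)

definition d :: nat where "d = period A"

lemma connected: obtains k where "k \<ge> 1" "matpow A k $ i $ j > 0"
  using irred by (auto simp: irreducible_matrix_def)

lemma period_at_dvd:
  assumes "k \<ge> 1" "matpow A k $ l $ l > 0"
  shows "period_at A l dvd k"
  using assms by (auto simp: period_at_def intro: Gcd_dvd)

text \<open>A closed walk at \<open>m\<close> can be inserted into a round trip from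
  \<open>l\<close> through \<open>m\<close>. The trip with and without the insertion is closed at
  \<open>l\<close>, and the two lengths differ by exactly \<open>k\<close>.\<close>

lemma period_at_dvd_period_at: "period_at A l dvd period_at A m"
  unfolding period_at_def[of A m]
proof (rule Gcd_greatest, clarify)
  fix k assume k: "1 \<le> k" "matpow A k $ m $ m > 0"
  obtain a b where ab: "a \<ge> 1" "matpow A a $ l $ m > 0" "matpow A b $ m $ l > 0"
    using connected by metis
  have "matpow A (a + b) $ l $ l > 0" "matpow A (a + k + b) $ l $ l > 0"
    using ab k nonneg by (auto intro: matpow_pos_add)
  then have "period_at A l dvd a + b" "period_at A l dvd a + k + b"
    using ab(1) by (auto intro!: period_at_dvd)
  moreover have "a + k + b = k + (a + b)" by simp
  ultimately show "period_at A l dvd k" using dvd_add_left_iff by metis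
qed

lemma d_eq: "d = period_at A l"
proof -
  have "period_at A i = period_at A l" for i
    by (rule dvd_antisym) (rule period_at_dvd_period_at)+
  then show ?thesis by (auto simp: d_def period_def intro!: the_equality)
qed

lemma d_pos: "d > 0"
proof -
  obtain k where "k \<ge> 1" "matpow A k $ undefined $ undefined > 0" by (rule connected)
  then have "d dvd k" by (metis d_eq period_at_dvd)
  with \<open>k \<ge> 1\<close> show ?thesis by (auto intro: Nat.gr0I)
qed

lemma d_dvd: "matpow A k $ l $ l > 0 \<Longrightarrow> d dvd k"
  by (cases "k = 0") (auto simp: d_eq[of l] intro: period_at_dvd)

text \<open>One and the same return walk closes both walks, and closed walks have length divisible
  by \<open>d\<close>.\<close>

lemma walk_cong:
  assumes "matpow A a $ i $ j > 0" "matpow A b $ i $ j > 0"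
  shows "[a = b] (mod d)"
proof -
  obtain k where "matpow A k $ j $ i > 0" using connected by metis
  then have "d dvd a + k" "d dvd b + k"
    using assms matpow_pos_add[OF nonneg] d_dvd by blast+
  then have "[a + k = b + k] (mod d)"
    by (simp add: cong_def)
  then show ?thesis by (simp only: cong_add_rcancel_nat)
qed

text \<open>The arbitrary vertex \<open>undefined\<close> is the base vertex, and \<open>cls\<close> is not reduced modulo \<open>d\<close>.\<close>

definition cls :: "'n \<Rightarrow> nat" where "cls l = (SOME k. matpow A k $ undefined $ l > 0)"

lemma cls_walk: "matpow A (cls l) $ undefined $ l > 0"
  unfolding cls_def by (rule someI_ex) (metis connected)

lemma cls_cong:
  assumes "matpow A k $ i $ j > 0"
  shows "[cls j = cls i + k] (mod d)"
  by (rule walk_cong) (rule cls_walk matpow_pos_add[OF nonneg cls_walk assms])+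

text \<open>A walk of length divisible by \<open>d\<close> does not change the residue. Conversely,
  if the residues agree, any connecting walk has length divisible by \<open>d\<close> and is
  therefore a walk for \<open>matpow A d\<close>.\<close>

lemma same_cyclic_class_iff: "same_cyclic_class A i j \<longleftrightarrow> [cls i = cls j] (mod d)"
proof -
  \<comment> \<open>Reachability in one direction already gives congruence, a symmetric relation, so
    both halves of \<open>communicates\<close> say the same.\<close>
  have walk_iff: "(\<exists>k. matpow (matpow A d) k $ i $ j > 0) \<longleftrightarrow> [cls i = cls j] (mod d)" for i j
  proof
    assume "\<exists>k. matpow (matpow A d) k $ i $ j > 0"
    then obtain k where "matpow A (d * k) $ i $ j > 0" by (auto simp: matpow_mult)
    then have "[cls j = cls i + d * k] (mod d)" by (rule cls_cong)
    then show "[cls i = cls j] (mod d)" by (simp add: cong_def)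
  next
    assume *: "[cls i = cls j] (mod d)"
    obtain k where k: "matpow A k $ i $ j > 0" using connected by metis
    have "[cls i + k = cls i + 0] (mod d)"
      using cls_cong[OF k] * by (simp add: cong_def)
    then have "[k = 0] (mod d)" by (simp only: cong_add_lcancel_nat)
    then obtain m where "k = d * m" by (auto simp: cong_0_iff)
    with k show "\<exists>k. matpow (matpow A d) k $ i $ j > 0" by (auto simp: matpow_mult)
  qed
  show ?thesis
    unfolding same_cyclic_class_def communicates_def d_def[symmetric] walk_iff
    by (auto intro: cong_sym)
qed

lemma pow_cls_step:
  fixes \<mu> :: complex
  assumes "\<mu> ^ d = 1" "A $ i $ j > 0"
  shows "\<mu> ^ cls j = \<mu> * \<mu> ^ cls i"
proof -
  have "[cls j = cls i + 1] (mod d)" by (rule cls_cong) (use assms in simp)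
  then have "\<mu> ^ cls j = \<mu> ^ (cls i + 1)" by (rule power_cong_root_of_unity[OF assms(1)])
  then show ?thesis by simp
qed

end

section \<open>Generalized eigenvectors\<close>

lemma tdot_add_right: "tdot x (y + z) = tdot x y + tdot x z"
  by (simp add: tdot_def distrib_left sum.distrib)

lemma tdot_diff_right: "tdot x (y - z) = tdot x y - tdot x z"
  by (simp add: tdot_def right_diff_distrib sum_subtractf)

lemma tdot_scale_right: "tdot x (c *s y) = c * tdot x y"
  by (simp add: tdot_def sum_distrib_left mult_ac)

lemma tdot_scale_left: "tdot (c *s x) y = c * tdot x y"
  by (simp add: tdot_def sum_distrib_left mult_ac)

lemma tdot_zero [simp]: "tdot x 0 = 0" "tdot 0 x = 0"
  by (simp_all add: tdot_def)

lemma tdot_sum_right: "tdot x (\<Sum>i\<in>S. f i) = (\<Sum>i\<in>S. tdot x (f i))"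
  by (induction S rule: infinite_finite_induct) (simp_all add: tdot_add_right)

lemma tdot_vector_matrix: "tdot (x v* A) y = tdot x (A *v y)"
proof -
  have "tdot (x v* A) y = (\<Sum>j\<in>UNIV. \<Sum>i\<in>UNIV. x $ i * A $ i $ j * y $ j)"
    by (simp only: tdot_def vector_matrix_mult_def vec_lambda_beta sum_distrib_right)
  also have "\<dots> = (\<Sum>i\<in>UNIV. \<Sum>j\<in>UNIV. x $ i * (A $ i $ j * y $ j))"
    by (subst sum.swap) (simp add: mult_ac)
  also have "\<dots> = tdot x (A *v y)"
    by (simp only: tdot_def matrix_vector_mult_def vec_lambda_beta sum_distrib_left)
  finally show ?thesis .
qed

lemma matrix_vector_mult_sum: "A *v (\<Sum>i\<in>S. f i) = (\<Sum>i\<in>S. A *v f i)"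
  for A :: "complex ^ 'n ^ 'm"
  by (induction S rule: infinite_finite_induct) (simp_all add: matrix_vector_right_distrib)

lemma shift_mult_vec: "(A - mat \<mu>) *v x = A *v x - \<mu> *s x"
  for A :: "complex ^ 'n ^ 'n"
proof -
  have "mat \<mu> *v x = \<mu> *s x"
    by (simp add: vec_eq_iff matrix_vector_mult_def mat_def mult_delta_left mult_delta_right)
  then show ?thesis by (simp add: matrix_vector_mult_diff_rdistrib)
qed

lemma vec_mult_shift: "x v* (A - mat \<mu>) = x v* A - \<mu> *s x"
  for A :: "complex ^ 'n ^ 'n"
proof -
  have "x v* mat \<mu> = \<mu> *s x"
    by (simp add: vec_eq_iff vector_matrix_mult_def mat_def mult_delta_left mult_delta_right)
  then show ?thesis by (simp add: vector_matrix_mult_diff_rdistrib)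
qed

lemma matpow_shift_right:
  fixes A :: "complex ^ 'n ^ 'n"
  assumes "A *v x = \<kappa> *s x"
  shows "matpow (A - mat \<mu>) k *v x = (\<kappa> - \<mu>) ^ k *s x"
proof (induction k)
  case (Suc k)
  have "matpow (A - mat \<mu>) (Suc k) *v x = (A - mat \<mu>) *v (matpow (A - mat \<mu>) k *v x)"
    by (simp only: matpow.simps matrix_vector_mul_assoc)
  also have "\<dots> = (\<kappa> - \<mu>) ^ k *s ((A - mat \<mu>) *v x)"
    by (simp only: Suc vector_scalar_commute)
  also have "\<dots> = (\<kappa> - \<mu>) ^ Suc k *s x"
    by (simp only: shift_mult_vec assms power_Suc2 vec.scale_left_diff_distrib vector_smult_assoc)
       (simp add: vec_eq_iff algebra_simps)
  finally show ?case .
qed simp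

lemma matpow_shift_left:
  fixes A :: "complex ^ 'n ^ 'n"
  assumes "x v* A = \<kappa> *s x"
  shows "x v* matpow (A - mat \<mu>) k = (\<kappa> - \<mu>) ^ k *s x"
proof (induction k)
  case (Suc k)
  have "x v* matpow (A - mat \<mu>) (Suc k) = (x v* (A - mat \<mu>)) v* matpow (A - mat \<mu>) k"
    by (simp only: matpow.simps vector_matrix_mul_assoc)
  also have "x v* (A - mat \<mu>) = (\<kappa> - \<mu>) *s x"
    by (simp only: vec_mult_shift assms vec.scale_left_diff_distrib)
  also have "((\<kappa> - \<mu>) *s x) v* matpow (A - mat \<mu>) k = (\<kappa> - \<mu>) *s (x v* matpow (A - mat \<mu>) k)"
    by (simp only: scalar_vector_matrix_assoc)
  finally show ?case using Suc by simp
qed simp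

text \<open>Moving the power of \<open>A - mat \<nu>\<close> that annihilates \<open>y\<close> over
  to \<open>x\<close> makes it act as the nonzero scalar
  \<open>(\<kappa> - \<nu>) ^ k\<close>.\<close>

lemma tdot_left_gen_right:
  assumes "x v* A = \<kappa> *s x" "gen_right_eigenvector A \<nu> y" "\<kappa> \<noteq> \<nu>"
  shows "tdot x y = 0"
proof -
  obtain k where "matpow (A - mat \<nu>) k *v y = 0"
    using assms(2) by (auto simp: gen_right_eigenvector_def)
  then have "(\<kappa> - \<nu>) ^ k * tdot x y = 0"
    using tdot_vector_matrix[of x "matpow (A - mat \<nu>) k" y]
    by (simp add: matpow_shift_left[OF assms(1)] tdot_scale_left)
  then show ?thesis using assms(3) by simp
qed

lemma tdot_gen_left_right:
  assumes "gen_left_eigenvector A \<nu> x" "A *v y = \<kappa> *s y" "\<kappa> \<noteq> \<nu>"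
  shows "tdot x y = 0"
proof -
  obtain k where "x v* matpow (A - mat \<nu>) k = 0"
    using assms(1) by (auto simp: gen_left_eigenvector_def)
  then have "(\<kappa> - \<nu>) ^ k * tdot x y = 0"
    using tdot_vector_matrix[of x "matpow (A - mat \<nu>) k" y]
    by (simp add: matpow_shift_right[OF assms(2)] tdot_scale_right)
  then show ?thesis using assms(3) by simp
qed

lemma gen_right_eigenvector_imp_right:
  assumes "gen_right_eigenvector A \<nu> y"
  obtains m where "right_eigenvector A \<nu> (matpow (A - mat \<nu>) m *v y)"
proof -
  \<comment> \<open>The chain of \<open>y\<close> under the shift ends at the least annihilating
    exponent; the vector just before it is the last nonzero one and hence a proper
    eigenvector.\<close>
  define k where "k = (LEAST k. matpow (A - mat \<nu>) k *v y = 0)"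
  have k: "matpow (A - mat \<nu>) k *v y = 0"
    unfolding k_def by (rule LeastI_ex) (use assms in \<open>auto simp: gen_right_eigenvector_def\<close>)
  have "y \<noteq> 0" using assms by (simp add: gen_right_eigenvector_def)
  with k have "k \<noteq> 0" by (intro notI) simp
  then obtain m where m: "k = Suc m" using not0_implies_Suc by blast
  then have nz: "matpow (A - mat \<nu>) m *v y \<noteq> 0"
    using not_less_Least[of m "\<lambda>k. matpow (A - mat \<nu>) k *v y = 0"] by (simp add: k_def)
  have "(A - mat \<nu>) *v (matpow (A - mat \<nu>) m *v y) = 0"
    using k by (simp add: m matrix_vector_mul_assoc)
  then have "right_eigenvector A \<nu> (matpow (A - mat \<nu>) m *v y)"
    using nz by (simp add: right_eigenvector_def shift_mult_vec)
  then show thesis by (rule that)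
qed

text \<open>The shift sends each member into the span of members of smaller rank \<open>g\<close>
  with the same eigenvalue, so it kills a member after more steps than its rank. The abstract rank
  serves both for right vectors and, in reversed order, for left ones.\<close>

lemma matpow_shift_triangular_family:
  fixes A :: "complex ^ 'n ^ 'n" and c :: "'i::finite \<Rightarrow> 'i \<Rightarrow> complex" and g :: "'i \<Rightarrow> nat"
  assumes step: "\<And>i. (A - mat (\<nu> i)) *v x i = (\<Sum>k\<in>UNIV. c i k *s x k)"
    and c: "\<And>i k. c i k \<noteq> 0 \<Longrightarrow> g k < g i \<and> \<nu> k = \<nu> i"
  shows "g i < m \<Longrightarrow> matpow (A - mat (\<nu> i)) m *v x i = 0"
proof (induction m arbitrary: i)
  case (Suc m)
  have "c i k *s (matpow (A - mat (\<nu> i)) m *v x k) = 0" for k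
  proof (cases "c i k = 0")
    case False
    with c[OF this] Suc.prems Suc.IH[of k] show ?thesis by auto
  qed simp
  then have "matpow (A - mat (\<nu> i)) m *v (\<Sum>k\<in>UNIV. c i k *s x k) = 0"
    by (simp add: matrix_vector_mult_sum flip: vector_scalar_commute)
  then show ?case
    by (simp only: matpow_Suc_right step flip: matrix_vector_mul_assoc)
qed simp

text \<open>The right vectors are the columns of \<open>P\<close> and the left vectors the rows of
  \<open>Q\<close>. Then \<open>Q ** P = mat 1\<close> is the duality and
  \<open>P ** Q = mat 1\<close> the expansion.\<close>

lemma generalized_eigenbasis:
  fixes A :: "complex ^ 'n ^ 'n"
  obtains rc pr :: "'n \<Rightarrow> complex ^ 'n" and \<nu> :: "'n \<Rightarrow> complex"
  where "\<And>i. gen_right_eigenvector A (\<nu> i) (rc i)"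
    "\<And>i. gen_left_eigenvector A (\<nu> i) (pr i)"
    "\<And>i j. tdot (pr i) (rc j) = (if i = j then 1 else 0)"
    "\<And>x. x = (\<Sum>i\<in>UNIV. tdot (pr i) x *s rc i)"
proof -
  obtain P Q J :: "complex ^ 'n ^ 'n" and f :: "'n \<Rightarrow> nat"
    where PQ: "P ** Q = mat 1" and QP: "Q ** P = mat 1" and AP: "A ** P = P ** J"
      and QA: "Q ** A = J ** Q"
      and J: "\<And>i j. J $ i $ j \<noteq> 0 \<Longrightarrow> i = j \<or> (f i < f j \<and> J $ i $ i = J $ j $ j)"
    using jordan_form_vec by blast
  define \<nu> where "\<nu> i = J $ i $ i" for i
  define rc where "rc i = column i P" for i
  define pr where "pr i = row i Q" for i
  define N where "N = Max (range f)"
  have fN: "f i \<le> N" for i by (simp add: N_def)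
  have orth: "tdot (pr i) (rc j) = (if i = j then 1 else 0)" for i j
    using arg_cong[OF QP, of "\<lambda>M. M $ i $ j"]
    by (simp add: tdot_def pr_def rc_def row_def column_def matrix_matrix_mult_def mat_def)
  have nonzero: "rc i \<noteq> 0" "pr i \<noteq> 0" for i
    using orth[of i i] by auto
  \<comment> \<open>Subtracting the eigenvalue cancels the diagonal term and leaves the strictly
    triangular part of \<open>J\<close>.\<close>
  have split: "(\<Sum>k\<in>UNIV. J $ k $ i * u k) - \<nu> i * u i
      = (\<Sum>k\<in>UNIV. (if k = i then 0 else J $ k $ i) * u k)" for i u
    by (simp add: \<nu>_def sum.remove[of UNIV i])
  have split': "(\<Sum>k\<in>UNIV. J $ i $ k * u k) - \<nu> i * u i
      = (\<Sum>k\<in>UNIV. (if k = i then 0 else J $ i $ k) * u k)" for i u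
    by (simp add: \<nu>_def sum.remove[of UNIV i])
  have "(A - mat (\<nu> i)) *v rc i = (\<Sum>k\<in>UNIV. (if k = i then 0 else J $ k $ i) *s rc k)" for i
  proof -
    have "(A *v rc i) $ l = (\<Sum>k\<in>UNIV. J $ k $ i * P $ l $ k)" for l
      using arg_cong[OF AP, of "\<lambda>M. M $ l $ i"]
      by (simp add: rc_def matrix_matrix_mult_def matrix_vector_mult_def column_def mult.commute)
    then show ?thesis
      by (simp add: shift_mult_vec vec_eq_iff) (simp add: rc_def column_def split)
  qed
  then have "matpow (A - mat (\<nu> i)) (Suc (f i)) *v rc i = 0" for i
    by (rule matpow_shift_triangular_family[where g = f]) (use J in \<open>auto simp: \<nu>_def split: if_splits\<close>)
  then have right: "gen_right_eigenvector A (\<nu> i) (rc i)" for i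
    unfolding gen_right_eigenvector_def using nonzero by blast
  have step: "(transpose A - mat (\<nu> i)) *v pr i = (\<Sum>k\<in>UNIV. (if k = i then 0 else J $ i $ k) *s pr k)"
    for i
  proof -
    have "(transpose A *v pr i) $ l = (\<Sum>k\<in>UNIV. J $ i $ k * Q $ k $ l)" for l
      using arg_cong[OF QA, of "\<lambda>M. M $ i $ l"]
      by (simp add: pr_def matrix_matrix_mult_def matrix_vector_mult_def row_def transpose_def
          mult.commute)
    then have "((transpose A - mat (\<nu> i)) *v pr i) $ l
        = (\<Sum>k\<in>UNIV. (if k = i then 0 else J $ i $ k) *s pr k) $ l" for l
      using split'[of i "\<lambda>k. Q $ k $ l"]
      by (simp add: shift_mult_vec del: transpose_matrix_vector) (simp add: pr_def row_def)
    then show ?thesis by (subst vec_eq_iff) blast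
  qed
  \<comment> \<open>Rows of \<open>Q\<close> are coupled to rows with larger \<open>f\<close>,
    contrary to the columns of \<open>P\<close>; the rank \<open>N - f\<close> reverses the
    order.\<close>
  have c: "N - f k < N - f i \<and> \<nu> k = \<nu> i" if "(if k = i then 0 else J $ i $ k) \<noteq> 0" for i k
  proof -
    have "f i < f k" "J $ i $ i = J $ k $ k"
      using that J[of i k] by (auto split: if_splits)
    then show ?thesis using fN[of k] by (auto simp: \<nu>_def)
  qed
  have "matpow (transpose A - mat (\<nu> i)) (Suc (N - f i)) *v pr i = 0" for i
    by (rule matpow_shift_triangular_family[where g = "\<lambda>i. N - f i", OF step c lessI])
  moreover have "transpose A - mat \<mu> = transpose (A - mat \<mu>)" for \<mu>
    by (auto simp: transpose_def mat_def vec_eq_iff)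
  ultimately have "pr i v* matpow (A - mat (\<nu> i)) (Suc (N - f i)) = 0" for i
    by (simp only: matpow_transpose transpose_matrix_vector)
  then have left: "gen_left_eigenvector A (\<nu> i) (pr i)" for i
    unfolding gen_left_eigenvector_def using nonzero by blast
  have expand: "x = (\<Sum>i\<in>UNIV. tdot (pr i) x *s rc i)" for x
  proof -
    have "x $ l = (\<Sum>i\<in>UNIV. tdot (pr i) x *s rc i) $ l" for l
    proof -
      have "x $ l = (P *v (Q *v x)) $ l" by (simp add: matrix_vector_mul_assoc PQ)
      also have "\<dots> = (\<Sum>i\<in>UNIV. P $ l $ i * tdot (pr i) x)"
        by (simp add: matrix_vector_mult_def[of P] matrix_vector_mult_def[of Q] tdot_def pr_def row_def)
      also have "\<dots> = (\<Sum>i\<in>UNIV. tdot (pr i) x *s rc i) $ l"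
        by (simp add: rc_def column_def mult.commute)
      finally show ?thesis .
    qed
    then show ?thesis by (subst vec_eq_iff) blast
  qed
  show thesis
    by (rule that[where \<nu> = \<nu> and rc = rc and pr = pr, OF right left orth expand])
qed

section \<open>The unimodular spectrum\<close>

lemma finite_type_maximum:
  fixes f :: "'i::finite \<Rightarrow> 'b::linorder"
  shows "\<exists>i. \<forall>j. f j \<le> f i"
proof -
  have "Max (range f) \<in> range f" by (rule Max_in) auto
  then obtain i where "Max (range f) = f i" by blast
  moreover have "f j \<le> Max (range f)" for j by (rule Max_ge) auto
  ultimately show ?thesis by metis
qed

text \<open>The equality case of the Cauchy-Schwarz inequality in the plane, obtained by expanding
  \<open>(cmod (y - u))\<^sup>2\<close>.\<close>

lemma cmod_dominated_eq:
  assumes "cmod y \<le> cmod u" "(cmod u)\<^sup>2 \<le> Re (cnj u * y)"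
  shows "y = u"
proof -
  have "(cmod (y - u))\<^sup>2 = (cmod y)\<^sup>2 + (cmod u)\<^sup>2 - 2 * Re (cnj u * y)"
    unfolding cmod_power2 by (simp add: power2_eq_square algebra_simps)
  also have "\<dots> \<le> 0"
    using assms(2) power_mono[OF assms(1) norm_ge_zero, of 2] by linarith
  finally show ?thesis by simp
qed

lemma cmat_mult_component: "(cmat A *v x) $ i = (\<Sum>j\<in>UNIV. complex_of_real (A $ i $ j) * x $ j)"
  by (simp add: cmat_def matrix_vector_mult_def)

text \<open>Orthogonality of characters: multiplication by a primitive root \<open>\<omega>\<close>
  permutes the roots but multiplies the sum by \<open>\<omega> ^ a / \<omega> ^ b\<close>, which
  differs from 1 unless the exponents are congruent.\<close>

lemma sum_roots_unity_power_ratio: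
  assumes "d > 0"
  shows "(\<Sum>\<mu> | \<mu> ^ d = 1. \<mu> ^ a / \<mu> ^ b) = (if [a = b] (mod d) then of_nat d else (0 :: complex))"
proof -
  let ?S = "\<Sum>\<mu> | \<mu> ^ d = (1 :: complex). \<mu> ^ a / \<mu> ^ b"
  show ?thesis
  proof (cases "[a = b] (mod d)")
    case True
    have ratio: "\<mu> ^ a / \<mu> ^ b = 1" if "\<mu> ^ d = 1" for \<mu> :: complex
    proof -
      have "\<mu> ^ a = \<mu> ^ b" by (rule power_cong_root_of_unity[OF that True])
      moreover have "\<mu> \<noteq> 0" using that assms by (auto simp: power_0_left)
      ultimately show ?thesis by simp
    qed
    have "?S = (\<Sum>\<mu> \<in> {\<mu> :: complex. \<mu> ^ d = 1}. 1)"
      by (intro sum.cong) (auto simp only: ratio mem_Collect_eq)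
    then show ?thesis using True assms by (simp add: card_roots_unity_eq)
  next
    case False
    define \<omega> where "\<omega> = cis (2 * pi / d)"
    have \<omega>_pow: "\<omega> ^ k = cis (2 * pi * k / d)" for k
      by (simp add: \<omega>_def Complex.DeMoivre mult_ac)
    have \<omega>: "\<omega> ^ d = 1" using assms by (simp add: \<omega>_pow)
    then have "\<omega> \<noteq> 0" using assms by (auto simp: power_0_left)
    have "\<omega> ^ a \<noteq> \<omega> ^ b"
    proof
      assume "\<omega> ^ a = \<omega> ^ b"
      then have "\<omega> ^ (a mod d) = \<omega> ^ (b mod d)"
        by (metis power_cong_root_of_unity[OF \<omega>] cong_mod_left cong_refl)
      then have "a mod d = b mod d"
        using bij_betw_imp_inj_on[OF Complex.bij_betw_roots_unity[OF assms]] assms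
        by (auto simp: \<omega>_pow dest!: inj_onD)
      with False show False by (simp add: cong_def)
    qed
    have "bij_betw ((*) \<omega>) {\<mu>. \<mu> ^ d = 1} {\<mu>. \<mu> ^ d = 1}"
      by (rule bij_betw_byWitness[where f' = "\<lambda>\<mu>. \<mu> / \<omega>"])
         (use \<omega> \<open>\<omega> \<noteq> 0\<close> in \<open>auto simp: power_mult_distrib power_divide\<close>)
    then have "?S = (\<Sum>\<mu> | \<mu> ^ d = 1. (\<omega> * \<mu>) ^ a / (\<omega> * \<mu>) ^ b)"
      by (rule sum.reindex_bij_betw[symmetric])
    also have "\<dots> = (\<omega> ^ a / \<omega> ^ b) * ?S"
      by (simp add: power_mult_distrib sum_distrib_left)
    finally have "(\<omega> ^ b - \<omega> ^ a) * ?S = 0"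
      using \<open>\<omega> \<noteq> 0\<close> by (simp add: field_simps)
    then have "?S = 0" using \<open>\<omega> ^ a \<noteq> \<omega> ^ b\<close> by simp
    then show ?thesis using False by simp
  qed
qed

section \<open>Maximum modulus and the unimodular eigenvectors\<close>

context irreducible_stochastic
begin

text \<open>At a coordinate of largest modulus, the row of \<open>A\<close> forms an average of
  entries that are no larger.\<close>

lemma eigenvalue_cmod_le_1:
  assumes "cmat A *v x = \<mu> *s x" "x \<noteq> 0"
  shows "cmod \<mu> \<le> 1"
proof -
  obtain i where i: "\<And>j. cmod (x $ j) \<le> cmod (x $ i)"
    using finite_type_maximum[of "\<lambda>j. cmod (x $ j)"] by blast
  have "x $ i \<noteq> 0"
    using i assms(2) by (metis norm_le_zero_iff norm_zero vec_eq_iff zero_index)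
  have "cmod \<mu> * cmod (x $ i) = cmod (\<Sum>j\<in>UNIV. complex_of_real (A $ i $ j) * x $ j)"
    using arg_cong[OF assms(1), of "\<lambda>y. cmod (y $ i)"]
    by (simp add: cmat_mult_component norm_mult)
  also have "\<dots> \<le> (\<Sum>j\<in>UNIV. A $ i $ j * cmod (x $ i))"
    using nonneg i
    by (intro sum_norm_le) (simp add: norm_mult nonneg_matrix_def mult_left_mono)
  also have "\<dots> = cmod (x $ i)"
    by (simp add: row_sum flip: sum_distrib_right)
  finally show ?thesis using \<open>x $ i \<noteq> 0\<close> by simp
qed

text \<open>At a maximal coordinate, \<open>\<mu> * x $ i\<close> is an average of numbers of at
  most its own modulus. Such an average can only be attained if every number of positive weight
  equals it.\<close>

lemma unimodular_edge:
  assumes eig: "cmat A *v x = \<mu> *s x" and unit: "cmod \<mu> = 1"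
    and i: "\<And>j. cmod (x $ j) \<le> cmod (x $ i)" and edge: "A $ i $ k > 0"
  shows "x $ k = \<mu> * x $ i"
proof -
  define u where "u = \<mu> * x $ i"
  have u: "cmod (x $ j) \<le> cmod u" for j using i unit by (simp add: u_def norm_mult)
  \<comment> \<open>The defect of \<open>x $ j\<close> in the direction of \<open>u\<close>: it is
    nonnegative and its average over row \<open>i\<close> vanishes, so it is zero along every edge
    from \<open>i\<close>.\<close>
  define D where "D j = (cmod u)\<^sup>2 - Re (cnj u * x $ j)" for j
  have D_nonneg: "D j \<ge> 0" for j
  proof -
    have "Re (cnj u * x $ j) \<le> cmod u * cmod (x $ j)"
      using complex_Re_le_cmod[of "cnj u * x $ j"] by (simp only: norm_mult complex_mod_cnj)
    also have "\<dots> \<le> cmod u * cmod u" using u by (intro mult_left_mono) auto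
    finally show ?thesis by (simp add: D_def power2_eq_square)
  qed
  have "cnj u * u = cnj u * (\<Sum>j\<in>UNIV. complex_of_real (A $ i $ j) * x $ j)"
    using arg_cong[OF eig, of "\<lambda>y. y $ i"] by (simp add: cmat_mult_component u_def)
  then have "Re (cnj u * u) = (\<Sum>j\<in>UNIV. A $ i $ j * Re (cnj u * x $ j))"
    by (simp only: sum_distrib_left Re_sum) (simp add: algebra_simps)
  moreover have "Re (cnj u * u) = (cmod u)\<^sup>2"
    unfolding cmod_power2 by (simp add: power2_eq_square)
  ultimately have "(\<Sum>j\<in>UNIV. A $ i $ j * D j) = 0"
    by (simp add: D_def right_diff_distrib sum_subtractf row_sum flip: sum_distrib_right)
  then have "A $ i $ k * D k = 0"
    using nonneg D_nonneg by (subst (asm) sum_nonneg_eq_0_iff) (auto simp: nonneg_matrix_def)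
  then have "D k = 0" using edge by simp
  then show ?thesis
    using cmod_dominated_eq[OF u[of k]] by (simp add: D_def u_def)
qed

text \<open>Since \<open>\<mu>\<close> has modulus 1, the end of an edge from a maximal coordinate
  is again maximal, and the edge argument can be iterated.\<close>

lemma unimodular_walk:
  assumes eig: "cmat A *v x = \<mu> *s x" and unit: "cmod \<mu> = 1"
  shows "(\<And>j. cmod (x $ j) \<le> cmod (x $ i)) \<Longrightarrow> matpow A m $ i $ l > 0 \<Longrightarrow> x $ l = \<mu> ^ m * x $ i"
proof (induction m arbitrary: i)
  case 0
  then show ?case by (auto simp: mat_def split: if_splits)
next
  case (Suc m)
  obtain k where k: "A $ i $ k > 0" "matpow A m $ k $ l > 0"
    using matpow_Suc_posE[OF nonneg Suc.prems(2)] .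
  have "x $ k = \<mu> * x $ i"
    by (rule unimodular_edge[OF eig unit Suc.prems(1) k(1)])
  moreover from this have "cmod (x $ j) \<le> cmod (x $ k)" for j
    using Suc.prems(1)[of j] unit by (simp add: norm_mult)
  ultimately show ?case using Suc.IH[OF _ k(2)] by simp
qed

definition qv :: "complex \<Rightarrow> complex ^ 'n" where "qv \<mu> = (\<chi> l. \<mu> ^ cls l)"

definition pv :: "complex \<Rightarrow> complex ^ 'n" where "pv \<mu> = (\<chi> l. complex_of_real (v $ l) / \<mu> ^ cls l)"

text \<open>Each closed walk at a maximal coordinate returns the entry multiplied by a power of
  \<open>\<mu>\<close>, which must be 1. Walks from the base vertex then fix all entries in terms of
  the one there.\<close>

lemma unimodular_eigenvector:
  assumes eig: "cmat A *v x = \<mu> *s x" and unit: "cmod \<mu> = 1" and "x \<noteq> 0"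
  shows "\<mu> ^ d = 1" and "\<exists>c. x = c *s qv \<mu>"
proof -
  obtain i where i: "\<And>j. cmod (x $ j) \<le> cmod (x $ i)"
    using finite_type_maximum[of "\<lambda>j. cmod (x $ j)"] by blast
  have nz: "x $ i \<noteq> 0"
    using i assms(3) by (metis norm_le_zero_iff norm_zero vec_eq_iff zero_index)
  have "\<mu> \<noteq> 0" using unit by auto
  have closed: "\<mu> ^ k = 1" if "matpow A k $ i $ i > 0" for k
    using unimodular_walk[OF eig unit i that] nz by simp
  obtain k0 where k0: "k0 \<ge> 1" "matpow A k0 $ i $ i > 0" by (rule connected)
  \<comment> \<open>The multiplicative order of \<open>\<mu>\<close>. It divides every return length
    at \<open>i\<close>, hence also their greatest common divisor \<open>d\<close>.\<close>
  define m where "m = (LEAST m. m \<ge> 1 \<and> \<mu> ^ m = 1)"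
  have m: "m \<ge> 1 \<and> \<mu> ^ m = 1"
    unfolding m_def by (rule LeastI[of _ k0]) (use k0 closed in auto)
  have m_dvd: "m dvd k" if "\<mu> ^ k = 1" for k
  proof -
    have "\<mu> ^ (k mod m) = 1"
      using power_cong_root_of_unity[of \<mu> m "k mod m" k] that m by simp
    moreover have "k mod m < m" using m by simp
    ultimately have "k mod m = 0"
      using not_less_Least[of "k mod m" "\<lambda>m. m \<ge> 1 \<and> \<mu> ^ m = 1"] by (auto simp: m_def)
    then show ?thesis by auto
  qed
  have "m dvd d"
    unfolding d_eq[of i] period_at_def by (rule Gcd_greatest) (use closed m_dvd in auto)
  then show "\<mu> ^ d = 1" using m by (auto simp: power_mult)
  \<comment> \<open>A walk to the base vertex shows that the base vertex is maximal too, so walks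
    may be started there.\<close>
  obtain b where "matpow A b $ i $ undefined > 0" using connected by metis
  then have "x $ undefined = \<mu> ^ b * x $ i" by (rule unimodular_walk[OF eig unit i])
  then have "cmod (x $ j) \<le> cmod (x $ undefined)" for j
    using i[of j] unit by (simp add: norm_mult norm_power)
  then have "x $ l = \<mu> ^ cls l * x $ undefined" for l
    using unimodular_walk[OF eig unit _ cls_walk] by blast
  then have "x $ l = (x $ undefined *s qv \<mu>) $ l" for l
    by (metis qv_def vec_lambda_beta vector_smult_component mult.commute)
  then have "x = x $ undefined *s qv \<mu>" by (subst vec_eq_iff) blast
  then show "\<exists>c. x = c *s qv \<mu>" ..
qed

lemma root_nonzero: "\<mu> ^ d = 1 \<Longrightarrow> \<mu> \<noteq> (0 :: complex)"
  using d_pos by (auto simp: power_0_left)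

lemma entry_zero: "\<not> A $ i $ j > 0 \<Longrightarrow> A $ i $ j = 0"
  using nonneg by (auto simp: nonneg_matrix_def less_le)

lemma qv_right:
  assumes "\<mu> ^ d = 1"
  shows "cmat A *v qv \<mu> = \<mu> *s qv \<mu>"
proof -
  have "(cmat A *v qv \<mu>) $ i = (\<mu> *s qv \<mu>) $ i" for i
  proof -
    have step: "complex_of_real (A $ i $ j) * \<mu> ^ cls j = complex_of_real (A $ i $ j) * (\<mu> * \<mu> ^ cls i)" for j
    proof (cases "A $ i $ j > 0")
      case True
      show ?thesis by (simp only: pow_cls_step[OF assms True])
    qed (simp add: entry_zero)
    have "(cmat A *v qv \<mu>) $ i = (\<Sum>j\<in>UNIV. complex_of_real (A $ i $ j) * \<mu> ^ cls j)"
      by (simp add: cmat_mult_component qv_def)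
    also have "\<dots> = complex_of_real (\<Sum>j\<in>UNIV. A $ i $ j) * (\<mu> * \<mu> ^ cls i)"
      by (simp only: step of_real_sum sum_distrib_right)
    finally show ?thesis by (simp add: row_sum qv_def)
  qed
  then show ?thesis by (subst vec_eq_iff) blast
qed

lemma pv_left:
  assumes "\<mu> ^ d = 1"
  shows "pv \<mu> v* cmat A = \<mu> *s pv \<mu>"
proof -
  have "(pv \<mu> v* cmat A) $ l = (\<mu> *s pv \<mu>) $ l" for l
  proof -
    \<comment> \<open>Along an edge the class number grows by one, which turns
      \<open>1 / \<mu> ^ cls i\<close> into \<open>\<mu> / \<mu> ^ cls l\<close>; this factor no
      longer depends on \<open>i\<close>, and stationarity of \<open>v\<close> does the
      rest.\<close>
    have step: "complex_of_real (A $ i $ l) * (complex_of_real (v $ i) / \<mu> ^ cls i) =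
        complex_of_real (v $ i * A $ i $ l) * (\<mu> / \<mu> ^ cls l)" for i
    proof (cases "A $ i $ l > 0")
      case True
      show ?thesis
        unfolding pow_cls_step[OF assms True] using root_nonzero[OF assms] by simp
    qed (simp add: entry_zero)
    have "(pv \<mu> v* cmat A) $ l
        = (\<Sum>i\<in>UNIV. complex_of_real (A $ i $ l) * (complex_of_real (v $ i) / \<mu> ^ cls i))"
      by (simp add: vector_matrix_mult_def cmat_def pv_def mult.commute)
    also have "\<dots> = complex_of_real (\<Sum>i\<in>UNIV. v $ i * A $ i $ l) * (\<mu> / \<mu> ^ cls l)"
      by (simp only: step of_real_sum sum_distrib_right)
    finally show ?thesis by (simp add: left_sum pv_def)
  qed
  then show ?thesis by (subst vec_eq_iff) blast
qed

text \<open>Left and right eigenvectors for different eigenvalues annihilate each other; for equal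
  roots the powers cancel and the total mass of \<open>v\<close> remains.\<close>

lemma tdot_pv_qv:
  assumes "\<mu> ^ d = 1" "\<kappa> ^ d = 1"
  shows "tdot (pv \<mu>) (qv \<kappa>) = (if \<mu> = \<kappa> then 1 else 0)"
proof (cases "\<mu> = \<kappa>")
  case True
  have "tdot (pv \<kappa>) (qv \<kappa>) = complex_of_real (\<Sum>i\<in>UNIV. v $ i)"
    using root_nonzero[OF assms(2)] by (simp add: tdot_def pv_def qv_def)
  then show ?thesis using True by (simp add: sum_v)
next
  case False
  have "\<mu> * tdot (pv \<mu>) (qv \<kappa>) = \<kappa> * tdot (pv \<mu>) (qv \<kappa>)"
    using tdot_vector_matrix[of "pv \<mu>" "cmat A" "qv \<kappa>"]
    by (simp add: qv_right pv_left assms tdot_scale_left tdot_scale_right)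
  then show ?thesis using False by simp
qed

lemma qv_nonzero: "\<mu> ^ d = 1 \<Longrightarrow> qv \<mu> \<noteq> 0"
  and pv_nonzero: "\<mu> ^ d = 1 \<Longrightarrow> pv \<mu> \<noteq> 0"
  using tdot_pv_qv[of \<mu> \<mu>] by auto

lemma qv_1: "qv 1 = 1"
  by (simp add: qv_def vec_eq_iff)

lemma pv_1: "pv 1 = cvec v"
  by (simp add: pv_def cvec_def vec_eq_iff)

lemma unimodular_eigenvalues:
  "{\<mu> \<in> eigenvalues (cmat A). cmod \<mu> = 1} = {\<mu>. \<mu> ^ d = 1}"
proof (intro subset_antisym subsetI)
  fix \<mu> assume "\<mu> \<in> {\<mu> \<in> eigenvalues (cmat A). cmod \<mu> = 1}"
  then show "\<mu> \<in> {\<mu>. \<mu> ^ d = 1}"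
    using unimodular_eigenvector(1) by (auto simp: eigenvalues_def right_eigenvector_def)
next
  fix \<mu> :: complex assume "\<mu> \<in> {\<mu>. \<mu> ^ d = 1}"
  then have \<mu>: "\<mu> ^ d = 1" by simp
  then have "right_eigenvector (cmat A) \<mu> (qv \<mu>)"
    by (simp add: right_eigenvector_def qv_right qv_nonzero)
  moreover have "cmod \<mu> = 1"
    using \<mu> d_pos by (metis norm_ge_zero norm_one norm_power power_eq_1_iff less_imp_neq)
  ultimately show "\<mu> \<in> {\<mu> \<in> eigenvalues (cmat A). cmod \<mu> = 1}"
    by (auto simp: eigenvalues_def)
qed

lemma finite_roots: "finite {\<mu> :: complex. \<mu> ^ d = 1}"
  using d_pos by (intro finite_roots_unity) simp

text \<open>After exchanging the sums, orthogonality of characters selects the vertices in the class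
  of \<open>l\<close>, each with factor \<open>d\<close>.\<close>

lemma class_sum_roots:
  "(\<Sum>\<mu> | \<mu> ^ d = 1. tdot (pv \<mu>) x *s qv \<mu>) $ l
    = of_nat d * (\<Sum>i | same_cyclic_class A i l. complex_of_real (v $ i) * x $ i)"
proof -
  have "(\<Sum>\<mu> | \<mu> ^ d = 1. tdot (pv \<mu>) x *s qv \<mu>) $ l
      = (\<Sum>\<mu> | \<mu> ^ d = 1. \<Sum>i\<in>UNIV. complex_of_real (v $ i) * x $ i * (\<mu> ^ cls l / \<mu> ^ cls i))"
    by (simp add: tdot_def pv_def qv_def sum_distrib_left mult_ac)
  also have "\<dots> = (\<Sum>i\<in>UNIV. complex_of_real (v $ i) * x $ i *
      (\<Sum>\<mu> | \<mu> ^ d = 1. \<mu> ^ cls l / \<mu> ^ cls i))"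
    by (subst sum.swap) (simp only: sum_distrib_left)
  also have "\<dots> = (\<Sum>i\<in>UNIV. if same_cyclic_class A i l then of_nat d * (complex_of_real (v $ i) * x $ i) else 0)"
    by (intro sum.cong refl)
       (auto simp: sum_roots_unity_power_ratio[OF d_pos] same_cyclic_class_iff cong_sym_eq)
  also have "\<dots> = of_nat d * (\<Sum>i | same_cyclic_class A i l. complex_of_real (v $ i) * x $ i)"
    by (simp add: sum_distrib_left sum.If_cases)
  finally show ?thesis .
qed

text \<open>The constant vector \<open>qv 1\<close> is reproduced by the sum of projections, so
  every cyclic class has the same mass \<open>1 / d\<close> under \<open>v\<close>. This identifies
  the weights in \<open>class_mean\<close>.\<close>

lemma class_mass: "real d * (\<Sum>i | same_cyclic_class A i l. v $ i) = 1"
proof -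
  have "(\<Sum>\<mu> | \<mu> ^ d = 1. tdot (pv \<mu>) (qv 1) *s qv \<mu>)
      = (\<Sum>\<mu> | \<mu> ^ d = (1 :: complex). if \<mu> = 1 then qv 1 else 0)"
    by (intro sum.cong refl) (auto simp: tdot_pv_qv)
  also have "\<dots> = qv 1" using finite_roots by simp
  finally have "complex_of_real (real d * (\<Sum>i | same_cyclic_class A i l. v $ i)) = 1"
    using class_sum_roots[of "qv 1" l] by (simp add: qv_1)
  then show ?thesis by (simp only: of_real_eq_1_iff)
qed

lemma cvec_class_mean:
  "cvec (class_mean A v z) = (\<Sum>\<mu> | \<mu> ^ d = 1. tdot (pv \<mu>) (cvec z) *s qv \<mu>)"
proof -
  have "(\<Sum>l2 | same_cyclic_class A l2 l. v $ l2) = 1 / real d" for l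
    using class_mass[of l] d_pos by (simp add: field_simps)
  then have "class_mean A v z $ l = real d * (\<Sum>i | same_cyclic_class A i l. v $ i * z $ i)" for l
    by (simp add: class_mean_def sum_distrib_left mult_ac)
  then show ?thesis
    by (simp add: vec_eq_iff class_sum_roots del: sum_component) (simp add: cvec_def)
qed

end

section \<open>The complementary spectral projection\<close>

lemma gen_right_eigenvector_eigenvalue:
  assumes "gen_right_eigenvector B \<nu> y"
  shows "\<nu> \<in> eigenvalues B"
  using gen_right_eigenvector_imp_right[OF assms] by (auto simp: eigenvalues_def)

context irreducible_stochastic
begin

text \<open>The spectral projection that removes the unimodular eigenvectors. It turns out to be the
  map that yields the third component.\<close>

definition residual :: "complex ^ 'n \<Rightarrow> complex ^ 'n" where
  "residual x = x - (\<Sum>\<mu> | \<mu> ^ d = 1. tdot (pv \<mu>) x *s qv \<mu>)"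

lemma residual_add: "residual (x + y) = residual x + residual y"
  by (simp add: residual_def tdot_add_right vec.scale_left_distrib sum.distrib)

lemma residual_scale: "residual (c *s x) = c *s residual x"
  by (simp add: residual_def tdot_scale_right vec.scale_right_diff_distrib vec.scale_sum_right)

lemma residual_diff: "residual (x - y) = residual x - residual y"
  by (simp add: residual_def tdot_diff_right vec.scale_left_diff_distrib sum_subtractf)

lemma residual_zero [simp]: "residual 0 = 0"
  by (simp add: residual_def)

lemma residual_sum: "residual (\<Sum>i\<in>S. f i) = (\<Sum>i\<in>S. residual (f i))"
  by (induction S rule: infinite_finite_induct) (simp_all add: residual_add)

lemma tdot_root_combination:
  assumes "\<kappa> ^ d = 1"
  shows "tdot (pv \<kappa>) (\<Sum>\<mu> | \<mu> ^ d = 1. c \<mu> *s qv \<mu>) = c \<kappa>"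
proof -
  have "tdot (pv \<kappa>) (\<Sum>\<mu> | \<mu> ^ d = 1. c \<mu> *s qv \<mu>)
      = (\<Sum>\<mu> | \<mu> ^ d = 1. if \<kappa> = \<mu> then c \<mu> else 0)"
    unfolding tdot_sum_right tdot_scale_right
    by (intro sum.cong refl) (use assms in \<open>auto simp: tdot_pv_qv\<close>)
  also have "\<dots> = c \<kappa>" using finite_roots assms by simp
  finally show ?thesis .
qed

lemma tdot_residual: "\<kappa> ^ d = 1 \<Longrightarrow> tdot (pv \<kappa>) (residual x) = 0"
  by (simp add: residual_def tdot_diff_right tdot_root_combination)

lemma residual_eq_self: "(\<And>\<mu>. \<mu> ^ d = 1 \<Longrightarrow> tdot (pv \<mu>) x = 0) \<Longrightarrow> residual x = x"
  by (simp add: residual_def)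

lemma residual_gen_contracting:
  assumes "gen_right_eigenvector (cmat A) \<nu> y" "\<nu> ^ d \<noteq> 1"
  shows "residual y = y"
proof (rule residual_eq_self)
  fix \<mu> :: complex assume \<mu>: "\<mu> ^ d = 1"
  then have "\<mu> \<noteq> \<nu>" using assms(2) by blast
  then show "tdot (pv \<mu>) y = 0"
    by (rule tdot_left_gen_right[OF pv_left[OF \<mu>] assms(1)])
qed

lemma cmat_residual: "cmat A *v residual x = residual (cmat A *v x)"
proof -
  have "tdot (pv \<mu>) (cmat A *v x) = \<mu> * tdot (pv \<mu>) x" if "\<mu> ^ d = 1" for \<mu>
    using that by (simp add: pv_left tdot_scale_left flip: tdot_vector_matrix)
  moreover have "cmat A *v (c *s qv \<mu>) = (c * \<mu>) *s qv \<mu>" if "\<mu> ^ d = 1" for c \<mu>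
    using that by (simp add: vector_scalar_commute qv_right)
  ultimately show ?thesis
    by (simp add: residual_def matrix_vector_mult_diff_distrib matrix_vector_mult_sum mult.commute)
qed

lemma matpow_shift_residual:
  "matpow (cmat A - mat \<mu>) k *v residual x = residual (matpow (cmat A - mat \<mu>) k *v x)"
proof (induction k)
  case (Suc k)
  have shift: "(cmat A - mat \<mu>) *v residual y = residual ((cmat A - mat \<mu>) *v y)" for y
    by (simp only: shift_mult_vec cmat_residual residual_scale residual_diff)
  show ?case
    by (simp only: matpow.simps matrix_vector_mul_assoc[symmetric] Suc shift)
qed simp

text \<open>Unimodular eigenvalues carry no proper Jordan chain. Otherwise the chain of
  \<open>residual y\<close> would end in an eigenvector in the range of \<open>residual\<close>; it
  is a multiple of \<open>qv \<nu>\<close>, yet \<open>pv \<nu>\<close> annihilates that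
  range.\<close>

lemma residual_gen_unimodular:
  assumes gen: "gen_right_eigenvector (cmat A) \<nu> y" and \<nu>: "\<nu> ^ d = 1"
  shows "residual y = 0"
proof (rule ccontr)
  assume nz: "residual y \<noteq> 0"
  obtain k where "matpow (cmat A - mat \<nu>) k *v y = 0"
    using gen by (auto simp: gen_right_eigenvector_def)
  then have "matpow (cmat A - mat \<nu>) k *v residual y = 0"
    by (simp add: matpow_shift_residual)
  with nz have "gen_right_eigenvector (cmat A) \<nu> (residual y)"
    by (auto simp: gen_right_eigenvector_def)
  then obtain m where "right_eigenvector (cmat A) \<nu> (matpow (cmat A - mat \<nu>) m *v residual y)"
    by (rule gen_right_eigenvector_imp_right)
  \<comment> \<open>As \<open>residual\<close> commutes with the shift, the eigenvector ending the
    chain is itself of the form \<open>residual w\<close>.\<close>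
  then obtain w where w: "right_eigenvector (cmat A) \<nu> (residual w)"
    unfolding matpow_shift_residual by blast
  have "\<nu> \<in> {\<mu> \<in> eigenvalues (cmat A). cmod \<mu> = 1}"
    unfolding unimodular_eigenvalues using \<nu> by simp
  then obtain c where c: "residual w = c *s qv \<nu>"
    using unimodular_eigenvector(2) w by (auto simp: right_eigenvector_def)
  have "c = tdot (pv \<nu>) (residual w)" using \<nu> by (simp add: c tdot_scale_right tdot_pv_qv)
  also have "\<dots> = 0" by (rule tdot_residual[OF \<nu>])
  finally have "residual w = 0" by (simp add: c)
  then show False using w by (simp add: right_eigenvector_def)
qed

lemma unimodular_iff_root:
  assumes "\<nu> \<in> eigenvalues (cmat A)"
  shows "\<nu> ^ d = 1 \<longleftrightarrow> \<not> cmod \<nu> < 1"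
proof -
  have "cmod \<nu> \<le> 1"
    using assms eigenvalue_cmod_le_1 by (auto simp: eigenvalues_def right_eigenvector_def)
  moreover have "\<nu> ^ d = 1 \<longleftrightarrow> cmod \<nu> = 1"
    using unimodular_eigenvalues assms by blast
  ultimately show ?thesis by auto
qed

text \<open>On the Jordan basis \<open>residual\<close> acts as identity or zero, according to the
  modulus of the eigenvalue; only the contracting vectors survive in the expansion.\<close>

lemma residual_basis:
  obtains rr p :: "nat \<Rightarrow> complex ^ 'n" and \<nu> :: "nat \<Rightarrow> complex"
  where "\<nu> ` {1..CARD('n) - d} = {\<mu> \<in> eigenvalues (cmat A). cmod \<mu> < 1}"
    "\<And>j. j \<in> {1..CARD('n) - d} \<Longrightarrow> gen_right_eigenvector (cmat A) (\<nu> j) (rr j)"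
    "\<And>j. j \<in> {1..CARD('n) - d} \<Longrightarrow> gen_left_eigenvector (cmat A) (\<nu> j) (p j)"
    "\<And>x. residual x = (\<Sum>j=1..CARD('n) - d. tdot (p j) x *s rr j)"
proof -
  obtain rc pr :: "'n \<Rightarrow> complex ^ 'n" and \<nu> :: "'n \<Rightarrow> complex"
    where right: "\<And>i. gen_right_eigenvector (cmat A) (\<nu> i) (rc i)"
      and left: "\<And>i. gen_left_eigenvector (cmat A) (\<nu> i) (pr i)"
      and orth: "\<And>i j. tdot (pr i) (rc j) = (if i = j then 1 else 0)"
      and expand: "\<And>x. x = (\<Sum>i\<in>UNIV. tdot (pr i) x *s rc i)"
    by (rule generalized_eigenbasis[of "cmat A"]) (rule that; assumption)
  define S where "S = {i. cmod (\<nu> i) < 1}"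
  have root_iff: "\<nu> i ^ d = 1 \<longleftrightarrow> i \<notin> S" for i
    using unimodular_iff_root[OF gen_right_eigenvector_eigenvalue[OF right]] by (simp add: S_def)
  have res: "residual x = (\<Sum>i\<in>S. tdot (pr i) x *s rc i)" for x
  proof -
    have "residual x = (\<Sum>i\<in>UNIV. tdot (pr i) x *s residual (rc i))"
      by (subst (1) expand[of x]) (simp only: residual_sum residual_scale)
    also have "\<dots> = (\<Sum>i\<in>UNIV. if i \<in> S then tdot (pr i) x *s rc i else 0)"
      using residual_gen_contracting[OF right] residual_gen_unimodular[OF right]
      by (intro sum.cong refl) (auto simp: root_iff)
    also have "\<dots> = (\<Sum>i\<in>S. tdot (pr i) x *s rc i)"
      by (simp add: sum.If_cases)
    finally show ?thesis .
  qed
  have tdot_axis: "tdot y (axis l 1) = y $ l" for y :: "complex ^ 'n" and l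
    by (simp add: tdot_def axis_def mult_delta_right)
  \<comment> \<open>Both sides are the trace of the projection \<open>residual\<close>.\<close>
  have "(\<Sum>l\<in>UNIV. residual (axis l 1) $ l) = of_nat (card S)"
  proof -
    have "(\<Sum>l\<in>UNIV. residual (axis l 1) $ l) = (\<Sum>l\<in>UNIV. \<Sum>i\<in>S. pr i $ l * rc i $ l)"
      by (simp add: res tdot_axis)
    also have "\<dots> = (\<Sum>i\<in>S. tdot (pr i) (rc i))"
      by (subst sum.swap) (simp add: tdot_def)
    finally show ?thesis by (simp add: orth)
  qed
  moreover have "(\<Sum>l\<in>UNIV. residual (axis l 1) $ l) = of_nat CARD('n) - of_nat d"
  proof -
    have "(\<Sum>l\<in>UNIV. residual (axis l 1) $ l)
        = of_nat CARD('n) - (\<Sum>l\<in>UNIV. \<Sum>\<mu> | \<mu> ^ d = 1. pv \<mu> $ l * qv \<mu> $ l)"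
      by (simp add: residual_def tdot_axis sum_subtractf)
    also have "(\<Sum>l\<in>UNIV. \<Sum>\<mu> | \<mu> ^ d = 1. pv \<mu> $ l * qv \<mu> $ l)
        = (\<Sum>\<mu> | \<mu> ^ d = 1. tdot (pv \<mu>) (qv \<mu>))"
      by (subst sum.swap) (simp add: tdot_def)
    also have "\<dots> = of_nat d"
      using d_pos by (simp add: tdot_pv_qv card_roots_unity_eq)
    finally show ?thesis .
  qed
  \<comment> \<open>The sum form lets the equation pass from complex numbers to naturals without
    truncated subtraction.\<close>
  ultimately have "(of_nat (card S + d) :: complex) = of_nat CARD('n)"
    by (simp only: of_nat_add) (simp add: algebra_simps)
  then have "card S + d = CARD('n)" by (simp only: of_nat_eq_iff)
  then have "card S = CARD('n) - d" by simp
  then obtain h where h: "bij_betw h {1..CARD('n) - d} S"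
    using ex_bij_betw_nat_finite_1[of S] by (metis finite)
  have "(\<nu> \<circ> h) ` {1..CARD('n) - d} = \<nu> ` S"
    by (simp only: image_comp[symmetric] bij_betw_imp_surj_on[OF h])
  also have "\<dots> = {\<mu> \<in> eigenvalues (cmat A). cmod \<mu> < 1}"
  proof (intro subset_antisym subsetI)
    fix \<mu> assume "\<mu> \<in> \<nu> ` S"
    then show "\<mu> \<in> {\<mu> \<in> eigenvalues (cmat A). cmod \<mu> < 1}"
      using gen_right_eigenvector_eigenvalue[OF right] by (auto simp: S_def)
  next
    fix \<mu> assume "\<mu> \<in> {\<mu> \<in> eigenvalues (cmat A). cmod \<mu> < 1}"
    then obtain x where x: "x \<noteq> 0" "cmat A *v x = \<mu> *s x" and \<mu>: "cmod \<mu> < 1"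
      by (auto simp: eigenvalues_def right_eigenvector_def)
    \<comment> \<open>Every contracting eigenvalue is listed: its eigenvector has a nonzero
      coordinate, and pairing with a dual vector of another eigenvalue would give zero.\<close>
    have "\<exists>i. tdot (pr i) x \<noteq> 0"
    proof (rule ccontr)
      assume "\<not> ?thesis"
      then have "(\<Sum>i\<in>UNIV. tdot (pr i) x *s rc i) = 0" by simp
      with expand[of x] have "x = 0" by (rule trans)
      with x(1) show False ..
    qed
    then obtain i where "tdot (pr i) x \<noteq> 0" ..
    then have "\<mu> = \<nu> i" using tdot_gen_left_right[OF left x(2)] by blast
    then show "\<mu> \<in> \<nu> ` S" using \<mu> by (auto simp: S_def)
  qed
  finally have img: "(\<nu> \<circ> h) ` {1..CARD('n) - d} = {\<mu> \<in> eigenvalues (cmat A). cmod \<mu> < 1}" .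
  have "residual x = (\<Sum>j=1..CARD('n) - d. tdot ((pr \<circ> h) j) x *s (rc \<circ> h) j)" for x
    unfolding res comp_apply by (rule sum.reindex_bij_betw[OF h, symmetric])
  then show thesis
    by (rule that[OF img, of "rc \<circ> h" "pr \<circ> h", rotated 2]) (simp_all only: comp_apply left right)
qed

end

section \<open>The three components\<close>

lemma cvec_diff: "cvec (x - y) = cvec x - cvec y"
  by (simp add: cvec_def vec_eq_iff)

lemma cvec_scale_1: "cvec (c *s 1) = complex_of_real c *s 1"
  by (simp add: cvec_def vec_eq_iff)

lemma tdot_cvec: "tdot (cvec x) (cvec y) = complex_of_real (x \<bullet> y)"
  by (simp add: tdot_def cvec_def inner_vec_def)

lemma tdot_span_zero:
  assumes "x \<in> vec.span S" "\<And>y. y \<in> S \<Longrightarrow> tdot p y = 0"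
  shows "tdot p x = 0"
  using assms(1)
  by (induction rule: vec.span_induct_alt) (simp_all add: tdot_add_right tdot_scale_right assms(2))

context irreducible_stochastic
begin

lemma comp1_eq: "cvec (comp1 v z) = tdot (cvec v) (cvec z) *s 1"
  by (simp add: comp1_def cvec_scale_1 tdot_cvec)

lemma roots_split: "{\<mu> :: complex. \<mu> ^ d = 1} = insert 1 {\<mu>. \<mu> ^ d = 1 \<and> \<mu> \<noteq> 1}"
  by auto

text \<open>The root 1 contributes the global mean, which is just what is subtracted from the class
  mean.\<close>

lemma comp2_eq:
  "cvec (comp2 A v z) = (\<Sum>\<mu> | \<mu> ^ d = 1 \<and> \<mu> \<noteq> 1. tdot (pv \<mu>) (cvec z) *s qv \<mu>)"
proof -
  have "finite {\<mu> :: complex. \<mu> ^ d = 1 \<and> \<mu> \<noteq> 1}"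
    by (rule finite_subset[OF _ finite_roots]) auto
  then have "cvec (class_mean A v z) = tdot (cvec v) (cvec z) *s 1
      + (\<Sum>\<mu> | \<mu> ^ d = 1 \<and> \<mu> \<noteq> 1. tdot (pv \<mu>) (cvec z) *s qv \<mu>)"
    unfolding cvec_class_mean roots_split by (subst sum.insert) (simp_all add: qv_1 pv_1)
  then show ?thesis by (simp add: comp2_def cvec_diff cvec_scale_1 tdot_cvec)
qed

lemma comp3_eq: "cvec (comp3 A v z) = residual (cvec z)"
  by (simp add: comp3_def comp1_def comp2_def residual_def cvec_diff cvec_class_mean)

text \<open>Three maps separate the summands: pairing with \<open>pv 1\<close> sees only the first,
  while \<open>residual\<close> kills the second and fixes the third.\<close>

lemma independent_components:
  assumes "\<And>y. y \<in> R \<Longrightarrow> residual y = y" "Q \<subseteq> qv ` {\<mu>. \<mu> ^ d = 1 \<and> \<mu> \<noteq> 1}"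
  shows "independent_subspaces3 (vec.span {1}) (vec.span Q) (vec.span R)"
  unfolding independent_subspaces3_def
proof (intro ballI impI)
  fix x y z :: "complex ^ 'n"
  assume x: "x \<in> vec.span {1}" and y: "y \<in> vec.span Q" and z: "z \<in> vec.span R"
    and zero: "x + y + z = 0"
  have tz: "tdot (pv \<mu>) z = 0" if "\<mu> ^ d = 1" for \<mu>
    using assms(1) tdot_residual[OF that] by (intro tdot_span_zero[OF z]) metis
  have ty: "tdot (pv 1) y = 0"
    using assms(2) by (intro tdot_span_zero[OF y]) (auto simp: tdot_pv_qv)
  obtain c where c: "x = c *s 1" using x by (auto simp: vec.span_singleton)
  have "tdot (pv 1) (x + y + z) = c"
    by (simp add: tdot_add_right ty tz c tdot_scale_right tdot_pv_qv flip: qv_1)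
  then have "c = 0" unfolding zero by simp
  then have x0: "x = 0" by (simp add: c)
  have residual_qv: "residual (qv \<mu>) = 0" if "\<mu> ^ d = 1" for \<mu>
    using that by (intro residual_gen_unimodular[of \<mu>])
      (auto simp: gen_right_eigenvector_def qv_nonzero qv_right shift_mult_vec intro!: exI[of _ 1])
  have ry: "residual y = 0" using y
    by (induction rule: vec.span_induct_alt)
       (use assms(2) in \<open>auto simp: residual_add residual_scale residual_qv\<close>)
  have "residual z = z" using z
    by (induction rule: vec.span_induct_alt) (simp_all add: residual_add residual_scale assms(1))
  moreover have "residual (y + z) = 0" using zero x0 by simp
  ultimately have "z = 0" using ry by (simp add: residual_add)
  then show "x = 0 \<and> y = 0 \<and> z = 0" using zero x0 by simp
qed

text \<open>A pathwise equivalence. Deviations of a mean from a coordinate are finite weighted sums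
  of coordinate differences; conversely the last two components add up to the state minus a constant
  vector.\<close>

lemma synchronization_iff:
  "(\<forall>l1 l2. (\<lambda>n. z n $ l2 - z n $ l1) \<longlonglongrightarrow> 0)
    \<longleftrightarrow> (\<lambda>n. comp2 A v (z n)) \<longlonglongrightarrow> 0 \<and> (\<lambda>n. comp3 A v (z n)) \<longlonglongrightarrow> 0"
proof
  assume *: "\<forall>l1 l2. (\<lambda>n. z n $ l2 - z n $ l1) \<longlonglongrightarrow> 0"
  have weighted: "(\<lambda>n. \<Sum>i\<in>S. c i * (z n $ i - z n $ l)) \<longlonglongrightarrow> 0" for c S l
    using * by (intro tendsto_null_sum tendsto_mult_right_zero) simp
  have mean: "v \<bullet> y - y $ l = (\<Sum>i\<in>UNIV. v $ i * (y $ i - y $ l))" for y l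
    by (simp add: right_diff_distrib sum_subtractf sum_v inner_vec_def flip: sum_distrib_right)
  \<comment> \<open>The weights within a class add up to 1, so the coordinate can be moved under the
    sum; the normalizer is nonzero by \<open>class_mass\<close>.\<close>
  have class_mean: "class_mean A v y $ l - y $ l
      = (\<Sum>i | same_cyclic_class A i l. v $ i / (\<Sum>k | same_cyclic_class A k l. v $ k) * (y $ i - y $ l))"
    for y l
  proof -
    let ?m = "\<Sum>k | same_cyclic_class A k l. v $ k"
    have "?m \<noteq> 0" using class_mass[of l] by auto
    then have "(\<Sum>i | same_cyclic_class A i l. v $ i / ?m) = 1"
      by (simp flip: sum_divide_distrib)
    then have "(\<Sum>i | same_cyclic_class A i l. v $ i / ?m * y $ l) = y $ l"
      by (simp only: mult_1 flip: sum_distrib_right)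
    then show ?thesis
      by (simp only: class_mean_def vec_lambda_beta right_diff_distrib sum_subtractf)
  qed
  have "(\<lambda>n. (class_mean A v (z n) $ l - z n $ l) - (v \<bullet> z n - z n $ l)) \<longlonglongrightarrow> 0 - 0" for l
    unfolding mean class_mean by (intro tendsto_diff weighted)
  then have c2: "(\<lambda>n. comp2 A v (z n)) \<longlonglongrightarrow> 0"
    by (intro vec_tendstoI) (simp add: comp2_def)
  have "(\<lambda>n. - (v \<bullet> z n - z n $ l) - comp2 A v (z n) $ l) \<longlonglongrightarrow> - 0 - 0 $ l" for l
    using weighted[where c = "\<lambda>i. v $ i" and S = UNIV and l = l]
    by (intro tendsto_diff tendsto_minus tendsto_vec_nth[OF c2]) (simp only: mean)
  then have "(\<lambda>n. comp3 A v (z n)) \<longlonglongrightarrow> 0"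
    by (intro vec_tendstoI) (simp add: comp3_def comp1_def)
  with c2 show "(\<lambda>n. comp2 A v (z n)) \<longlonglongrightarrow> 0 \<and> (\<lambda>n. comp3 A v (z n)) \<longlonglongrightarrow> 0" ..
next
  assume "(\<lambda>n. comp2 A v (z n)) \<longlonglongrightarrow> 0 \<and> (\<lambda>n. comp3 A v (z n)) \<longlonglongrightarrow> 0"
  then have "(\<lambda>n. comp2 A v (z n) + comp3 A v (z n)) \<longlonglongrightarrow> 0 + 0"
    by (intro tendsto_add) auto
  \<comment> \<open>The constant first component cancels in the difference of two
    coordinates.\<close>
  then have "(\<lambda>n. (comp2 A v (z n) + comp3 A v (z n)) $ l2 - (comp2 A v (z n) + comp3 A v (z n)) $ l1)
      \<longlonglongrightarrow> (0 + 0 :: real ^ 'n) $ l2 - (0 + 0 :: real ^ 'n) $ l1" for l1 l2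
    by (intro tendsto_diff tendsto_vec_nth)
  then show "\<forall>l1 l2. (\<lambda>n. z n $ l2 - z n $ l1) \<longlonglongrightarrow> 0"
    by (simp add: comp3_def comp1_def)
qed

text \<open>Numbers the two families from 1. For \<open>d = 1\<close> or \<open>d = CARD('n)\<close>
  the corresponding range is empty and the component is zero.\<close>

lemma spectral_decomposition:
  obtains q vl rr p :: "nat \<Rightarrow> complex ^ 'n" and \<mu> \<nu> :: "nat \<Rightarrow> complex"
  where "bij_betw \<mu> {1..d - 1} {\<mu> \<in> eigenvalues (cmat A). cmod \<mu> = 1 \<and> \<mu> \<noteq> 1}"
    "\<And>j. j \<in> {1..d - 1} \<Longrightarrow> right_eigenvector (cmat A) (\<mu> j) (q j) \<and> left_eigenvector (cmat A) (\<mu> j) (vl j)"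
    "\<nu> ` {1..CARD('n) - d} = {\<mu> \<in> eigenvalues (cmat A). cmod \<mu> < 1}"
    "\<And>j. j \<in> {1..CARD('n) - d} \<Longrightarrow>
      gen_right_eigenvector (cmat A) (\<nu> j) (rr j) \<and> gen_left_eigenvector (cmat A) (\<nu> j) (p j)"
    "\<And>z. cvec (comp2 A v z) = (\<Sum>j=1..d - 1. tdot (vl j) (cvec z) *s q j)"
    "\<And>z. cvec (comp3 A v z) = (\<Sum>j=1..CARD('n) - d. tdot (p j) (cvec z) *s rr j)"
    "independent_subspaces3 (vec.span {1}) (vec.span (q ` {1..d - 1})) (vec.span (rr ` {1..CARD('n) - d}))"
proof -
  obtain rr p :: "nat \<Rightarrow> complex ^ 'n" and \<nu> :: "nat \<Rightarrow> complex"
    where img: "\<nu> ` {1..CARD('n) - d} = {\<mu> \<in> eigenvalues (cmat A). cmod \<mu> < 1}"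
      and right: "\<And>j. j \<in> {1..CARD('n) - d} \<Longrightarrow> gen_right_eigenvector (cmat A) (\<nu> j) (rr j)"
      and left: "\<And>j. j \<in> {1..CARD('n) - d} \<Longrightarrow> gen_left_eigenvector (cmat A) (\<nu> j) (p j)"
      and res: "\<And>x. residual x = (\<Sum>j=1..CARD('n) - d. tdot (p j) x *s rr j)"
    by (rule residual_basis) (rule that; assumption)
  let ?R = "{\<mu> :: complex. \<mu> ^ d = 1 \<and> \<mu> \<noteq> 1}"
  have R: "{\<mu> \<in> eigenvalues (cmat A). cmod \<mu> = 1 \<and> \<mu> \<noteq> 1} = ?R"
    using unimodular_eigenvalues by blast
  have finite_R: "finite ?R" by (rule finite_subset[OF _ finite_roots]) auto
  \<comment> \<open>Of the \<open>d\<close> roots of unity, the root 1 belongs to the first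
    component and is left out.\<close>
  have "card {\<mu> :: complex. \<mu> ^ d = 1} = Suc (card ?R)"
    unfolding roots_split by (rule card_insert_disjoint[OF finite_R]) simp
  then have "card ?R = d - 1" using d_pos by (simp add: card_roots_unity_eq)
  then obtain \<mu> where \<mu>: "bij_betw \<mu> {1..d - 1} ?R"
    using ex_bij_betw_nat_finite_1[OF finite_R] by auto
  then have root: "\<mu> j ^ d = 1 \<and> \<mu> j \<noteq> 1" if "j \<in> {1..d - 1}" for j
    using that by (auto dest: bij_betwE)
  show thesis
  proof (rule that[of \<mu> "\<lambda>j. qv (\<mu> j)" "\<lambda>j. pv (\<mu> j)" \<nu> rr p])
    show "bij_betw \<mu> {1..d - 1} {\<mu> \<in> eigenvalues (cmat A). cmod \<mu> = 1 \<and> \<mu> \<noteq> 1}"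
      unfolding R by (rule \<mu>)
    show "right_eigenvector (cmat A) (\<mu> j) (qv (\<mu> j)) \<and> left_eigenvector (cmat A) (\<mu> j) (pv (\<mu> j))"
      if "j \<in> {1..d - 1}" for j
      using root[OF that]
      by (simp add: right_eigenvector_def left_eigenvector_def qv_right pv_left qv_nonzero pv_nonzero)
    show "\<nu> ` {1..CARD('n) - d} = {\<mu> \<in> eigenvalues (cmat A). cmod \<mu> < 1}" by (rule img)
    show "gen_right_eigenvector (cmat A) (\<nu> j) (rr j) \<and> gen_left_eigenvector (cmat A) (\<nu> j) (p j)"
      if "j \<in> {1..CARD('n) - d}" for j
      using right[OF that] left[OF that] ..
    show "cvec (comp2 A v z) = (\<Sum>j=1..d - 1. tdot (pv (\<mu> j)) (cvec z) *s qv (\<mu> j))" for z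
      unfolding comp2_eq by (rule sum.reindex_bij_betw[OF \<mu>, symmetric])
    show "cvec (comp3 A v z) = (\<Sum>j=1..CARD('n) - d. tdot (p j) (cvec z) *s rr j)" for z
      unfolding comp3_eq by (rule res)
    have "residual (rr j) = rr j" if "j \<in> {1..CARD('n) - d}" for j
    proof (rule residual_gen_contracting[OF right[OF that]])
      have "\<nu> j \<in> {\<mu> \<in> eigenvalues (cmat A). cmod \<mu> < 1}" using that by (simp flip: img)
      then show "\<nu> j ^ d \<noteq> 1" using unimodular_iff_root by blast
    qed
    then show "independent_subspaces3 (vec.span {1}) (vec.span ((\<lambda>j. qv (\<mu> j)) ` {1..d - 1}))
        (vec.span (rr ` {1..CARD('n) - d}))"
      by (intro independent_components) (use root in auto)
  qed
qed

end

theorem theorem2p1: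
  fixes W :: "real ^ 'n ^ 'n" and v :: "real ^ 'n" and r :: "nat \<Rightarrow> real"
    and M :: "'w measure" and X Z :: "nat \<Rightarrow> 'w \<Rightarrow> real ^ 'n"
  assumes "CARD('n) \<ge> 2"
    and "nonneg_matrix W" and "irreducible_matrix W" and "transpose W *v 1 = 1"
    and "\<And>l. v $ l > 0" and "v v* transpose W = v" and "v \<bullet> 1 = 1"
    and "\<And>n. 0 \<le> r n" and "\<And>n. r n < 1"
    and "prob_space M"
    and "Z 0 \<in> borel_measurable M"
    and "\<And>\<omega> l. \<omega> \<in> space M \<Longrightarrow> 0 \<le> Z 0 \<omega> $ l \<and> Z 0 \<omega> $ l \<le> 1"
    and "\<And>n. X (Suc n) \<in> borel_measurable M"
    and "\<And>n \<omega> l. \<omega> \<in> space M \<Longrightarrow> X (Suc n) \<omega> $ l \<in> {0, 1}"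
    and "\<And>n. cond_indep_vars M (history M Z X n) (\<lambda>_. borel) (\<lambda>l \<omega>. X (Suc n) \<omega> $ l) UNIV"
    and "\<And>n l. AE \<omega> in M.
           cond_probability M (history M Z X n) {\<omega>' \<in> space M. X (Suc n) \<omega>' $ l = 1} \<omega> =
           (transpose W *v Z n \<omega>) $ l"
    and "\<And>n \<omega>. \<omega> \<in> space M \<Longrightarrow> Z (Suc n) \<omega> = (1 - r n) *s Z n \<omega> + r n *s X (Suc n) \<omega>"
  defines "A \<equiv> transpose W"
  defines "nper \<equiv> period A"
  shows "{\<mu> \<in> eigenvalues (cmat A). cmod \<mu> = 1 \<and> \<mu> \<noteq> 1} = {\<mu>. \<mu> ^ nper = 1 \<and> \<mu> \<noteq> 1}
    \<and> (\<exists>(q :: nat \<Rightarrow> complex ^ 'n) (vl :: nat \<Rightarrow> complex ^ 'n) (\<mu> :: nat \<Rightarrow> complex)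
        (rr :: nat \<Rightarrow> complex ^ 'n) (p :: nat \<Rightarrow> complex ^ 'n) (\<nu> :: nat \<Rightarrow> complex).
        bij_betw \<mu> {1..nper - 1} {\<mu> \<in> eigenvalues (cmat A). cmod \<mu> = 1 \<and> \<mu> \<noteq> 1}
      \<and> (\<forall>j\<in>{1..nper - 1}.
           right_eigenvector (cmat A) (\<mu> j) (q j) \<and> left_eigenvector (cmat A) (\<mu> j) (vl j))
      \<and> \<nu> ` {1..CARD('n) - nper} = {\<mu> \<in> eigenvalues (cmat A). cmod \<mu> < 1}
      \<and> (\<forall>j\<in>{1..CARD('n) - nper}.
           gen_right_eigenvector (cmat A) (\<nu> j) (rr j) \<and> gen_left_eigenvector (cmat A) (\<nu> j) (p j))
      \<and> (\<forall>n. \<forall>\<omega>\<in>space M.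
           cvec (comp1 v (Z n \<omega>)) = tdot (cvec v) (cvec (Z n \<omega>)) *s 1
         \<and> cvec (comp1 v (Z n \<omega>)) \<in> vec.span {1}
         \<and> cvec (comp2 A v (Z n \<omega>)) = (\<Sum>j=1..nper - 1. tdot (vl j) (cvec (Z n \<omega>)) *s q j)
         \<and> cvec (comp2 A v (Z n \<omega>)) \<in> vec.span (q ` {1..nper - 1})
         \<and> cvec (comp3 A v (Z n \<omega>)) = (\<Sum>j=1..CARD('n) - nper. tdot (p j) (cvec (Z n \<omega>)) *s rr j)
         \<and> cvec (comp3 A v (Z n \<omega>)) \<in> vec.span (rr ` {1..CARD('n) - nper}))
      \<and> independent_subspaces3 (vec.span {1}) (vec.span (q ` {1..nper - 1}))
           (vec.span (rr ` {1..CARD('n) - nper})))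
    \<and> (complete_as_synchronization M Z \<longleftrightarrow>
         (AE \<omega> in M. (\<lambda>n. comp2 A v (Z n \<omega>)) \<longlonglongrightarrow> 0) \<and>
         (AE \<omega> in M. (\<lambda>n. comp3 A v (Z n \<omega>)) \<longlonglongrightarrow> 0))"
proof -
  interpret irreducible_stochastic A v
  proof
    show "nonneg_matrix A" using assms(2) by (simp add: A_def nonneg_matrix_def transpose_def)
    show "irreducible_matrix A" unfolding A_def by (rule irreducible_transpose) (rule assms(3))
    show "A *v 1 = 1" "v v* A = v" "v \<bullet> 1 = 1" unfolding A_def by (fact assms)+
    show "v $ l > 0" for l by (rule assms(5))
  qed
  have nper: "nper = d" by (simp add: nper_def d_def)
  have eigs: "{\<mu> \<in> eigenvalues (cmat A). cmod \<mu> = 1 \<and> \<mu> \<noteq> 1} = {\<mu>. \<mu> ^ d = 1 \<and> \<mu> \<noteq> 1}"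
    using unimodular_eigenvalues by blast
  have sync: "complete_as_synchronization M Z \<longleftrightarrow>
      (AE \<omega> in M. (\<lambda>n. comp2 A v (Z n \<omega>)) \<longlonglongrightarrow> 0) \<and>
      (AE \<omega> in M. (\<lambda>n. comp3 A v (Z n \<omega>)) \<longlonglongrightarrow> 0)"
  proof -
    \<comment> \<open>There are finitely many pairs of vertices, so the exceptional null sets can be
      merged and the pathwise equivalence applied.\<close>
    have "complete_as_synchronization M Z \<longleftrightarrow>
        (AE \<omega> in M. \<forall>l1 l2. (\<lambda>n. Z n \<omega> $ l2 - Z n \<omega> $ l1) \<longlonglongrightarrow> 0)"
      unfolding complete_as_synchronization_def by (simp only: AE_all_countable)
    then show ?thesis by (simp only: synchronization_iff AE_conj_iff)
  qed
  obtain q vl rr p :: "nat \<Rightarrow> complex ^ 'n" and \<mu> \<nu> :: "nat \<Rightarrow> complex"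
    where bij: "bij_betw \<mu> {1..d - 1} {\<mu> \<in> eigenvalues (cmat A). cmod \<mu> = 1 \<and> \<mu> \<noteq> 1}"
      and eig: "\<And>j. j \<in> {1..d - 1} \<Longrightarrow>
        right_eigenvector (cmat A) (\<mu> j) (q j) \<and> left_eigenvector (cmat A) (\<mu> j) (vl j)"
      and img: "\<nu> ` {1..CARD('n) - d} = {\<mu> \<in> eigenvalues (cmat A). cmod \<mu> < 1}"
      and gen: "\<And>j. j \<in> {1..CARD('n) - d} \<Longrightarrow>
        gen_right_eigenvector (cmat A) (\<nu> j) (rr j) \<and> gen_left_eigenvector (cmat A) (\<nu> j) (p j)"
      and c2: "\<And>z. cvec (comp2 A v z) = (\<Sum>j=1..d - 1. tdot (vl j) (cvec z) *s q j)"
      and c3: "\<And>z. cvec (comp3 A v z) = (\<Sum>j=1..CARD('n) - d. tdot (p j) (cvec z) *s rr j)"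
      and ind: "independent_subspaces3 (vec.span {1}) (vec.span (q ` {1..d - 1}))
        (vec.span (rr ` {1..CARD('n) - d}))"
    by (rule spectral_decomposition) (rule that; assumption)
  have span: "cvec (comp1 v z) \<in> vec.span {1}"
    "cvec (comp2 A v z) \<in> vec.span (q ` {1..d - 1})"
    "cvec (comp3 A v z) \<in> vec.span (rr ` {1..CARD('n) - d})" for z
    unfolding comp1_eq c2 c3
    by (auto intro!: vec.span_sum vec.span_scale intro: vec.span_base)
  show ?thesis
    unfolding nper
    by (rule conjI[OF eigs conjI[OF _ sync]], rule exI[of _ q], rule exI[of _ vl],
        rule exI[of _ \<mu>], rule exI[of _ rr], rule exI[of _ p], rule exI[of _ \<nu>])
      (intro conjI ballI allI bij img ind comp1_eq c2 c3 span
        eig[THEN conjunct1] eig[THEN conjunct2] gen[THEN conjunct1] gen[THEN conjunct2]; assumption)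
qed

end
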